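(* (1) The critical cardinalities of the properties $\mathsf{S}_1(\mathcal{B}_{\mathrm T},\mathcal{B}_{\mathrm T})$, $\mathsf{S}_1(\mathrm{T},\mathrm{T})$ and $\mathsf{S}_1(C_{\mathrm T},C_{\mathrm T})$ are all equal to $\mathfrak{t}$. (2) The critical cardinalities of the properties $\mathsf{S}_{fin}(\mathcal{B}_{\mathrm T},\mathcal{B}_{\mathrm T})$, $\mathsf{S}_{fin}(\mathrm{T},\mathrm{T})$ and $\mathsf{S}_{fin}(C_{\mathrm T},C_{\mathrm T})$ are all equal to $\min\{\mathfrak{s},\mathfrak{b}\}$.
   Context: A "set of reals" is an infinite, zero-dimensional, separable metrizable topological space $X$. A cover of $X$ is a family $\mathcal{U}$ of subsets of $X$ with $X\notin\mathcal{U}$ and $X=\bigcup\mathcal{U}$. All covers considered are countable. A cover $\mathcal{U}$ is a $\tau$-cover if $\{U\in\mathcal{U}: x\in U\}$ is infinite for every $x\in X$, and for all $x,y\in X$ either $\{U\in\mathcal{U}: x\in U, y\notin U\}$ is finite or $\{U\in\mathcal{U}: y\in U, x\notin U\}$ is finite. $\mathrm{T}$, $\mathcal{B}_{\mathrm T}$, $C_{\mathrm T}$ denote the collections of countable open, countable Borel, and countable clopen $\tau$-covers of $X$, respectively. $\mathsf{S}_1(\mathscr{A},\mathscr{B})$: for each sequence $\langle\mathcal{U}_n:n\in\mathbb{N}\rangle$ of members of $\mathscr{A}$ there are $U_n\in\mathcal{U}_n$, $n\in\mathbb{N}$, such that $\{U_n:n\in\mathbb{N}\}\in\mathscr{B}$.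 $\mathsf{S}_{fin}(\mathscr{A},\mathscr{B})$: for each sequence $\langle\mathcal{U}_n:n\in\mathbb{N}\rangle$ of members of $\mathscr{A}$ there are finite (possibly empty) $\mathcal{F}_n\subseteq\mathcal{U}_n$, $n\in\mathbb{N}$, such that $\bigcup_{n}\mathcal{F}_n\in\mathscr{B}$. The critical cardinality of a property $P$ of sets of reals is the minimal cardinality of a set of reals not satisfying $P$. Cardinals: $\mathfrak{b}$ is the minimal cardinality of a $\leq^*$-unbounded subset of $\mathbb{N}^{\mathbb{N}}$; $\mathfrak{s}$ is the minimal cardinality of a splitting family $S\subseteq[\mathbb{N}]^{\aleph_0}$ (for every infinite $a\subseteq\mathbb{N}$ there is $s\in S$ with $a\cap s$ and $a\setminus s$ both infinite); $\mathfrak{t}$ is the minimal cardinality of a family $T\subseteq[\mathbb{N}]^{\aleph_0}$ that is linearly ordered by $\subseteq^*$ (inclusion modulo finite) and has no pseudo-intersection (an infinite $a\subseteq\mathbb{N}$ with $a\subseteq^* t$ for all $t\in T$). *)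

theory Defs
  imports "HOL-Analysis.Analysis"
begin

unbundle cardinal_syntax

text \<open>Cardinals are well-orders up to order isomorphism, as in
  \<^theory>\<open>HOL.BNF_Cardinal_Order_Relation\<close>. The field of \<open>\<kappa>\<close> may have any type, so that
  cardinals living on different types can be compared.\<close>

definition is_min_card :: "('a set \<Rightarrow> bool) \<Rightarrow> 'b rel \<Rightarrow> bool" where
  "is_min_card Q \<kappa> \<longleftrightarrow> (\<exists>A. Q A \<and> |A| =o \<kappa>) \<and> (\<forall>A. Q A \<longrightarrow> \<kappa> \<le>o |A| )"

definition min_card :: "('a set \<Rightarrow> bool) \<Rightarrow> 'a rel" where
  "min_card Q = (SOME \<kappa>. is_min_card Q \<kappa>)"

text \<open>The choice in \<^const>\<open>min_card\<close> is not arbitrary as soon as some set satisfies \<open>Q\<close>.\<close>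

lemma is_min_card_min_card:
  assumes "Q A"
  shows "is_min_card Q (min_card Q)"
proof -
  let ?R = "card_of ` {A. Q A}"
  have "?R \<noteq> {}" "\<forall>r\<in>?R. Card_order r"
    using assms by (auto simp: card_of_Card_order)
  then obtain r where "r \<in> ?R" "\<forall>r'\<in>?R. r \<le>o r'"
    using exists_minim_Card_order by metis
  then have "is_min_card Q r"
    by (auto simp: is_min_card_def card_of_refl)
  then show ?thesis
    unfolding min_card_def by (rule someI)
qed

lemma is_min_card_unique:
  assumes "is_min_card Q \<kappa>" "is_min_card Q \<mu>"
  shows "(\<kappa> :: 'b rel) =o (\<mu> :: 'c rel)"
  using assms unfolding is_min_card_def
  by (meson ordIso_iff_ordLeq ordLeq_ordIso_trans)

definition cmin :: "'a rel \<Rightarrow> 'b rel \<Rightarrow> ('a + 'b) rel" where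
  "cmin r s = (if r \<le>o s then |Inl ` Field r| else |Inr ` Field s| )"


definition le_star :: "(nat \<Rightarrow> nat) \<Rightarrow> (nat \<Rightarrow> nat) \<Rightarrow> bool" where
  "le_star f g \<longleftrightarrow> (\<forall>\<^sub>F n in sequentially. f n \<le> g n)"

definition unbounded_family :: "(nat \<Rightarrow> nat) set \<Rightarrow> bool" where
  "unbounded_family F \<longleftrightarrow> \<not> (\<exists>g. \<forall>f\<in>F. le_star f g)"

definition splitting_family :: "nat set set \<Rightarrow> bool" where
  "splitting_family S \<longleftrightarrow> (\<forall>s\<in>S. infinite s) \<and>
     (\<forall>a. infinite a \<longrightarrow> (\<exists>s\<in>S. infinite (a \<inter> s) \<and> infinite (a - s)))"

definition subset_star :: "nat set \<Rightarrow> nat set \<Rightarrow> bool" where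
  "subset_star a b \<longleftrightarrow> finite (a - b)"

definition pseudo_intersection :: "nat set \<Rightarrow> nat set set \<Rightarrow> bool" where
  "pseudo_intersection a T \<longleftrightarrow> infinite a \<and> (\<forall>t\<in>T. subset_star a t)"

definition tower :: "nat set set \<Rightarrow> bool" where
  "tower T \<longleftrightarrow> (\<forall>t\<in>T. infinite t) \<and>
     (\<forall>s\<in>T. \<forall>t\<in>T. subset_star s t \<or> subset_star t s) \<and>
     \<not> (\<exists>a. pseudo_intersection a T)"

definition bounding_number :: "(nat \<Rightarrow> nat) rel" where
  "bounding_number = min_card unbounded_family"

definition splitting_number :: "nat set rel" where
  "splitting_number = min_card splitting_family"

definition tower_number :: "nat set rel" where
  "tower_number = min_card tower"


text \<open>\<open>X dim_le 0\<close> is the existence of a base of clopen sets: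
  see \<open>dimension_le_0_neighbourhood_base_of_clopen\<close>.\<close>

definition set_of_reals :: "'a topology \<Rightarrow> bool" where
  "set_of_reals X \<longleftrightarrow>
     infinite (topspace X) \<and> X dim_le 0 \<and> separable_space X \<and> metrizable_space X"

definition is_cover :: "'a topology \<Rightarrow> 'a set set \<Rightarrow> bool" where
  "is_cover X \<U> \<longleftrightarrow> topspace X \<notin> \<U> \<and> topspace X = \<Union>\<U>"

definition tau_cover :: "'a topology \<Rightarrow> 'a set set \<Rightarrow> bool" where
  "tau_cover X \<U> \<longleftrightarrow> is_cover X \<U> \<and>
     (\<forall>x\<in>topspace X. infinite {U\<in>\<U>. x \<in> U}) \<and>
     (\<forall>x\<in>topspace X. \<forall>y\<in>topspace X.
        finite {U\<in>\<U>. x \<in> U \<and> y \<notin> U} \<or> finite {U\<in>\<U>. y \<in> U \<and> x \<notin> U})"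

definition borel_in :: "'a topology \<Rightarrow> 'a set \<Rightarrow> bool" where
  "borel_in X B \<longleftrightarrow> B \<in> sigma_sets (topspace X) {U. openin X U}"

definition open_tau_covers :: "'a topology \<Rightarrow> 'a set set set" where
  "open_tau_covers X = {\<U>. countable \<U> \<and> tau_cover X \<U> \<and> (\<forall>U\<in>\<U>. openin X U)}"

definition borel_tau_covers :: "'a topology \<Rightarrow> 'a set set set" where
  "borel_tau_covers X = {\<U>. countable \<U> \<and> tau_cover X \<U> \<and> (\<forall>U\<in>\<U>. borel_in X U)}"

definition clopen_tau_covers :: "'a topology \<Rightarrow> 'a set set set" where
  "clopen_tau_covers X =
     {\<U>. countable \<U> \<and> tau_cover X \<U> \<and> (\<forall>U\<in>\<U>. openin X U \<and> closedin X U)}"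

definition S1 :: "'a set set set \<Rightarrow> 'a set set set \<Rightarrow> bool" where
  "S1 \<A> \<B> \<longleftrightarrow> (\<forall>\<U> :: nat \<Rightarrow> 'a set set. (\<forall>n. \<U> n \<in> \<A>) \<longrightarrow>
     (\<exists>U. (\<forall>n. U n \<in> \<U> n) \<and> range U \<in> \<B>))"

definition Sfin :: "'a set set set \<Rightarrow> 'a set set set \<Rightarrow> bool" where
  "Sfin \<A> \<B> \<longleftrightarrow> (\<forall>\<U> :: nat \<Rightarrow> 'a set set. (\<forall>n. \<U> n \<in> \<A>) \<longrightarrow>
     (\<exists>\<F>. (\<forall>n. finite (\<F> n) \<and> \<F> n \<subseteq> \<U> n) \<and> (\<Union>n. \<F> n) \<in> \<B>))"

text \<open>\<open>critical_cardinality P \<kappa>\<close>: the critical cardinality of \<open>P\<close> is \<open>\<kappa>\<close>. The spaces range over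
  all topologies whose underlying set is a subset of the type \<open>'a\<close>. A separable metrizable space
  has at most continuum many points, so as soon as \<open>'a\<close> has at least continuum many elements,
  every set of reals has a homeomorphic copy among these spaces.\<close>

definition critical_cardinality :: "('a topology \<Rightarrow> bool) \<Rightarrow> 'b rel \<Rightarrow> bool" where
  "critical_cardinality P \<kappa> \<longleftrightarrow>
     is_min_card (\<lambda>A. \<exists>X. set_of_reals X \<and> topspace X = A \<and> \<not> P X) \<kappa>"

end

theory Submission
  imports Defs
begin

text \<open>Lower bounds. Enumerate the \<open>n\<close>-th cover as \<open>V n m\<close>, so that a point \<open>x\<close> becomes the subset
  \<open>{(n, m). x \<in> V n m}\<close> of \<open>\<nat> \<times> \<nat>\<close>, whose rows are linearly ordered by \<open>\<subseteq>\<^sup>*\<close>. Below \<open>\<tt>\<close> each row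
  family has a pseudo-intersection, and as \<open>\<tt> \<le> \<bb>\<close> one can choose in all rows at once elements that
  eventually lie in every point. Below \<open>min {\<ss>, \<bb>}\<close> an infinite set of rows is unsplit by the sets
  \<open>{n. row n of x \<subseteq>\<^sup>* row n of y}\<close>, so that on these rows the order of \<open>x\<close> and \<open>y\<close> is eventually
  constant; selecting from row \<open>n\<close> the interval \<open>{g n..h n}\<close> with \<open>g\<close> and then \<open>h\<close> large enough
  yields a \<open>\<tau>\<close>-cover.

  Upper bounds. Points are taken to be subsets of \<open>\<nat> \<times> \<nat>\<close>. For a tower \<open>T\<close> and \<open>s \<subseteq> \<nat>\<close> let row
  \<open>n\<close> of a point be (a shift of) \<open>t \<in> T\<close> if \<open>n \<in> s\<close> and full otherwise. Every selection misses
  some \<open>t\<close> in infinitely many rows \<open>n\<close>, and if \<open>s\<close> splits this set of rows, then the points given by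
  \<open>t, s\<close> and \<open>t, - s\<close> are incomparable on the selection. For \<open>S\<^sub>1\<close> the set of even numbers is a good
  enough \<open>s\<close>; for \<open>S\<^sub>f\<^sub>i\<^sub>n\<close>, where rows may be skipped, \<open>s\<close> ranges over a splitting family. For
  \<open>\<bb>\<close>, the rows are cofinite with gaps \<open>[f n, g n)\<close>, for \<open>f, g\<close> in an unbounded family: if the maximum
  \<open>h n\<close> of the selection in row \<open>n\<close> lies below \<open>f n\<close> infinitely often and in \<open>[f n, g n)\<close> infinitely
  often, then the points with gaps \<open>[0, f n)\<close> and \<open>[f n, g n)\<close> are incomparable on the selection.\<close>

section \<open>Cardinal characteristics\<close>

lemma min_card_le:
  assumes "Q A"
  shows "min_card Q \<le>o |A|"
  using is_min_card_min_card[of Q, OF assms] assms by (auto simp: is_min_card_def)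

lemma min_card_witness:
  assumes "Q A"
  obtains B where "Q B" "|B| =o min_card Q"
  using is_min_card_min_card[of Q, OF assms] by (auto simp: is_min_card_def)

lemma card_less_min_card_imp_not:
  assumes "|A| <o min_card Q"
  shows "\<not> Q A"
  using assms min_card_le not_ordLess_ordLeq by blast

lemma Card_order_min_card:
  fixes Q :: "'a set \<Rightarrow> bool"
  assumes "Q A"
  shows "Card_order (min_card Q)"
proof -
  obtain B :: "'a set" where "|B| =o min_card Q"
    using min_card_witness[of Q A, OF assms] .
  then show ?thesis using card_of_Card_order Card_order_ordIso2 by blast
qed

lemma infinite_coinfinite_subset:
  assumes "infinite a"
  obtains b where "b \<subseteq> a" "infinite b" "infinite (a - b)"
proof -
  obtain b c where "b \<subseteq> a" "c \<subseteq> a" "infinite b" "infinite c" "b \<inter> c = {}"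
    using infinite_split[OF assms] .
  moreover have "c \<subseteq> a - b" using calculation by blast
  ultimately show ?thesis using that finite_subset by blast
qed

section \<open>Towers and what holds below the tower number\<close>

text \<open>Zorn gives a maximal chain under almost inclusion. An infinite, coinfinite part of a
  pseudo-intersection could be added to it, and would then almost contain that
  pseudo-intersection.\<close>

lemma tower_exists: "\<exists>T. tower T"
proof -
  define \<A> where "\<A> = {T. (\<forall>t\<in>T. infinite t) \<and> (\<forall>s\<in>T. \<forall>t\<in>T. subset_star s t \<or> subset_star t s)}"
  have "\<exists>M\<in>\<A>. \<forall>X\<in>\<A>. M \<subseteq> X \<longrightarrow> X = M"
  proof (rule subset_Zorn')
    fix C assume C: "subset.chain \<A> C"
    show "\<Union>C \<in> \<A>"
      unfolding \<A>_def
    proof (intro CollectI conjI ballI)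
      fix t assume "t \<in> \<Union>C"
      then show "infinite t" using C by (auto simp: subset.chain_def \<A>_def)
    next
      fix s t assume "s \<in> \<Union>C" "t \<in> \<Union>C"
      then obtain S T where ST: "S \<in> C" "T \<in> C" "s \<in> S" "t \<in> T" by blast
      have "S \<subseteq> T \<or> T \<subseteq> S" using C ST(1,2) by (auto simp: subset_chain_def)
      then obtain R where "R \<in> C" "s \<in> R" "t \<in> R" using ST by blast
      then show "subset_star s t \<or> subset_star t s"
        using C by (auto simp: subset_chain_def \<A>_def)
    qed
  qed
  then obtain M where M: "M \<in> \<A>" and max: "\<And>X. X \<in> \<A> \<Longrightarrow> M \<subseteq> X \<Longrightarrow> X = M" by blast
  have "\<not> pseudo_intersection a M" for a
  proof
    assume a: "pseudo_intersection a M"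
    then obtain b where b: "b \<subseteq> a" "infinite b" "infinite (a - b)"
      using infinite_coinfinite_subset unfolding pseudo_intersection_def by metis
    have bM: "subset_star b t" if "t \<in> M" for t
      using a b(1) that unfolding pseudo_intersection_def subset_star_def
      by (meson Diff_mono finite_subset order_refl)
    have "insert b M \<in> \<A>"
      using M b(2) bM by (auto simp: \<A>_def subset_star_def)
    then have "b \<in> M" using max[of "insert b M"] by blast
    then have "subset_star a b" using a by (auto simp: pseudo_intersection_def)
    then show False using b(3) by (auto simp: subset_star_def)
  qed
  then show ?thesis using M by (auto simp: tower_def \<A>_def)
qed

text \<open>The family is indexed and may repeat sets, so that the points of a space can serve as
  indices.\<close>

lemma pseudo_intersection_exists:
  assumes "|I| <o tower_number"
    and "\<And>i. i \<in> I \<Longrightarrow> infinite (T i)"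
    and "\<And>i j. i \<in> I \<Longrightarrow> j \<in> I \<Longrightarrow> subset_star (T i) (T j) \<or> subset_star (T j) (T i)"
  shows "\<exists>a. infinite a \<and> (\<forall>i\<in>I. subset_star a (T i))"
proof -
  have "|T ` I| <o tower_number" using card_of_image assms(1) ordLeq_ordLess_trans by blast
  then have "\<not> tower (T ` I)"
    unfolding tower_number_def by (rule card_less_min_card_imp_not)
  then obtain a where "pseudo_intersection a (T ` I)"
    unfolding tower_def using assms(2,3) by blast
  then show ?thesis by (auto simp: pseudo_intersection_def)
qed

lemma subset_star_trans: "subset_star a b \<Longrightarrow> subset_star b c \<Longrightarrow> subset_star a c"
  unfolding subset_star_def
  by (rule finite_subset[of _ "(a - b) \<union> (b - c)"]) auto

text \<open>Fewer than \<open>\<tt>\<close> open dense subsets of the preorder of infinite sets of naturals have a common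
  element: meet them one at a time along a well-order, building a descending tower.\<close>

lemma tower_number_dense:
  fixes I :: "'i set" and D :: "'i \<Rightarrow> nat set \<Rightarrow> bool"
  assumes I: "|I| <o tower_number"
    and op: "\<And>i a b. i \<in> I \<Longrightarrow> D i a \<Longrightarrow> infinite b \<Longrightarrow> subset_star b a \<Longrightarrow> D i b"
    and dense: "\<And>i a. i \<in> I \<Longrightarrow> infinite a \<Longrightarrow> \<exists>b\<subseteq>a. infinite b \<and> D i b"
  shows "\<exists>a. infinite a \<and> (\<forall>i\<in>I. D i a)"
proof -
  \<comment> \<open>The strict part of the well-order \<open>|I|\<close>, along which the tower is
    built.\<close>
  define R where "R = |I| - Id"
  have wo: "well_order_on I |I|" by (rule card_of_well_order_on)
  have RI: "i \<in> I \<and> j \<in> I" if "(i, j) \<in> R" for i j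
    using that wo unfolding R_def well_order_on_def linear_order_on_def partial_order_on_def
      preorder_on_def by auto
  have wf: "wf R" using wo by (simp add: R_def well_order_on_def)
  have tr: "(i, k) \<in> R" if "(i, j) \<in> R" "(j, k) \<in> R" for i j k
    using that wo unfolding R_def well_order_on_def linear_order_on_def partial_order_on_def
      preorder_on_def by (auto dest: transD antisymD)
  have tot: "(i, j) \<in> R \<or> (j, i) \<in> R" if "i \<in> I" "j \<in> I" "i \<noteq> j" for i j
    using that wo unfolding R_def well_order_on_def linear_order_on_def total_on_def by auto
  \<comment> \<open>\<open>P T i b\<close> says that \<open>b\<close> may follow the entries
    \<open>T j\<close> with \<open>j\<close> before \<open>i\<close>. Outside \<open>I\<close> it
    holds trivially, so that the recursion has a value at every index.\<close>
  define P where "P = (\<lambda>T i b. i \<in> I \<longrightarrow> infinite b \<and> D i b \<and> (\<forall>j. (j, i) \<in> R \<longrightarrow> subset_star b (T j)))"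
  have "\<exists>T. \<forall>i. P T i (T i)"
  proof (rule dependent_wf_choice[OF wf])
    show "P f x r = P g x r" if "\<And>z. (z, x) \<in> R \<Longrightarrow> f z = g z" for f g x r
      using that by (auto simp: P_def)
  next
    fix i T assume IH: "\<And>j. (j, i) \<in> R \<Longrightarrow> P T j (T j)"
    show "\<exists>r. P T i r"
    proof (cases "i \<in> I")
      case True
      \<comment> \<open>The earlier entries form a chain indexed by a subset of \<open>I\<close>,
        hence have a pseudo-intersection; density shrinks it to the next entry, at successor and
        limit stages alike.\<close>
      let ?J = "{j. (j, i) \<in> R}"
      have "?J \<subseteq> I" using RI by blast
      then have "|?J| <o tower_number" using I card_of_mono1 ordLeq_ordLess_trans by blast
      then have "\<exists>a. infinite a \<and> (\<forall>j\<in>?J. subset_star a (T j))"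
      proof (rule pseudo_intersection_exists)
        fix j assume "j \<in> ?J"
        then show "infinite (T j)" using IH RI by (auto simp: P_def)
      next
        fix j k assume jk: "j \<in> ?J" "k \<in> ?J"
        then have "j \<in> I" "k \<in> I" using RI by auto
        then show "subset_star (T j) (T k) \<or> subset_star (T k) (T j)"
          using tot[of j k] IH jk by (cases "j = k") (auto simp: P_def subset_star_def)
      qed
      then obtain a where a: "infinite a" "\<forall>j\<in>?J. subset_star a (T j)" by blast
      obtain b where b: "b \<subseteq> a" "infinite b" "D i b" using dense[OF True a(1)] by blast
      have "subset_star b a" using b(1) by (simp add: subset_star_def Diff_eq_empty_iff[THEN iffD2])
      then have "P T i b" using a b subset_star_trans unfolding P_def by blast
      then show ?thesis ..
    qed (auto simp: P_def)
  qed
  then obtain T where T: "\<And>i. P T i (T i)" by blast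
  have "\<exists>a. infinite a \<and> (\<forall>i\<in>I. subset_star a (T i))"
  proof (rule pseudo_intersection_exists[OF I])
    show "infinite (T i)" if "i \<in> I" for i using T that by (auto simp: P_def)
    show "subset_star (T i) (T j) \<or> subset_star (T j) (T i)" if "i \<in> I" "j \<in> I" for i j
      using tot[of i j] T that by (cases "i = j") (auto simp: P_def subset_star_def)
  qed
  then obtain a where a: "infinite a" "\<forall>i\<in>I. subset_star a (T i)" by blast
  have "D i a" if "i \<in> I" for i
    using op[of i "T i" a] T[of i] a that by (auto simp: P_def)
  then show ?thesis using a(1) by blast
qed

text \<open>This is t \<le> b in indexed form: for each \<open>i\<close> the sets that are sparse
  enough for \<open>f i\<close> are open and dense, and gaps of a common such set bound every
  \<open>f i\<close>.\<close>

lemma card_less_tower_number_imp_bounded: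
  fixes f :: "'i \<Rightarrow> nat \<Rightarrow> nat"
  assumes "|I| <o tower_number"
  shows "\<exists>g. \<forall>i\<in>I. le_star (f i) g"
proof -
  \<comment> \<open>All pairs \<open>k < l\<close> are compared, not only neighbours, which makes
    the passage to almost contained sets immediate.\<close>
  define D where "D = (\<lambda>i a. \<exists>N. \<forall>k\<in>a. \<forall>l\<in>a. N \<le> k \<longrightarrow> k < l \<longrightarrow> (\<forall>n\<le>k. f i n \<le> l))"
  have "\<exists>a. infinite a \<and> (\<forall>i\<in>I. D i a)"
  proof (rule tower_number_dense[OF assms])
    fix i a b assume "D i a" "subset_star b a"
    obtain N where N: "\<forall>k\<in>a. \<forall>l\<in>a. N \<le> k \<longrightarrow> k < l \<longrightarrow> (\<forall>n\<le>k. f i n \<le> l)"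
      using \<open>D i a\<close> by (auto simp: D_def)
    obtain M where M: "\<forall>m\<in>b - a. m < M"
      using \<open>subset_star b a\<close> unfolding subset_star_def finite_nat_set_iff_bounded by blast
    show "D i b" unfolding D_def
    proof (intro exI[of _ "max N M"] ballI impI allI)
      fix k l n assume kl: "k \<in> b" "l \<in> b" "max N M \<le> k" "k < l" "n \<le> k"
      then have "k \<in> a" "l \<in> a" using M by (metis DiffI leD le_trans max.bounded_iff less_imp_le)+
      then show "f i n \<le> l" using N kl by simp
    qed
  next
    fix i and a :: "nat set" assume a: "infinite a"
    \<comment> \<open>Thinning out \<open>a\<close>: the next element is taken beyond the current
      one \<open>x\<close> and beyond all \<open>f i n\<close> with
      \<open>n \<le> x\<close>.\<close>
    have "\<exists>e. \<forall>k. e k \<in> a \<and> (e k < e (Suc k) \<and> (\<forall>n\<le>e k. f i n \<le> e (Suc k)))"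
    proof (rule dependent_nat_choice)
      show "\<exists>x. x \<in> a" using a by (metis finite.emptyI equals0I)
      fix x k
      obtain y where y: "y \<in> a" "y > Max (insert x (f i ` {..x}))"
        using a by (meson infinite_nat_iff_unbounded)
      then have "x < y" "\<forall>n\<le>x. f i n \<le> y" by (simp_all add: less_imp_le)
      then show "\<exists>y. y \<in> a \<and> x < y \<and> (\<forall>n\<le>x. f i n \<le> y)" using y by blast
    qed
    then obtain e where e: "\<And>k. e k \<in> a" "\<And>k. e k < e (Suc k)"
      "\<And>k n. n \<le> e k \<Longrightarrow> f i n \<le> e (Suc k)" by blast
    have sm: "strict_mono e" using e(2) by (simp add: strict_mono_Suc_iff)
    have "D i (range e)" unfolding D_def
    proof (intro exI[of _ 0] ballI impI allI)
      fix k l n assume "k \<in> range e" "l \<in> range e" "k < l" "n \<le> k"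
      then obtain p q where "k = e p" "l = e q" by blast
      with \<open>k < l\<close> sm have "Suc p \<le> q" by (simp add: strict_mono_less Suc_le_eq)
      then have "e (Suc p) \<le> l" using sm \<open>l = e q\<close> by (simp add: strict_mono_less_eq)
      then show "f i n \<le> l" using e(3)[of n p] \<open>n \<le> k\<close> \<open>k = e p\<close> by simp
    qed
    moreover have "infinite (range e)"
      using sm strict_mono_imp_inj_on range_inj_infinite by blast
    ultimately show "\<exists>b\<subseteq>a. infinite b \<and> D i b" using e(1) by blast
  qed
  then obtain a where a: "infinite a" "\<And>i. i \<in> I \<Longrightarrow> D i a" by blast
  \<comment> \<open>Two elements beyond \<open>n\<close> are taken: the lower one
    \<open>k \<ge> n\<close> brings \<open>n\<close> into the range on which the upper one,
    \<open>g n\<close>, bounds \<open>f i\<close>.\<close>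
  have "\<forall>n. \<exists>l. \<exists>k\<in>a. n \<le> k \<and> k < l \<and> l \<in> a"
    using a(1) by (meson infinite_nat_iff_unbounded infinite_nat_iff_unbounded_le)
  then obtain g where g: "\<And>n. \<exists>k\<in>a. n \<le> k \<and> k < g n \<and> g n \<in> a" by metis
  have "le_star (f i) g" if i: "i \<in> I" for i
  proof -
    obtain N where N: "\<forall>k\<in>a. \<forall>l\<in>a. N \<le> k \<longrightarrow> k < l \<longrightarrow> (\<forall>n\<le>k. f i n \<le> l)"
      using a(2)[OF i] by (auto simp: D_def)
    have "f i n \<le> g n" if "N \<le> n" for n
      using g[of n] N that le_trans by meson
    then show ?thesis unfolding le_star_def eventually_sequentially by blast
  qed
  then show ?thesis by blast
qed

section \<open>Families below b and s, and infinite witnesses for the three cardinals\<close>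

lemma card_less_bounding_number_imp_bounded:
  fixes f :: "'i \<Rightarrow> nat \<Rightarrow> nat"
  assumes "|I| <o bounding_number"
  shows "\<exists>g. \<forall>i\<in>I. le_star (f i) g"
proof -
  have "|f ` I| <o bounding_number" using card_of_image assms ordLeq_ordLess_trans by blast
  then have "\<not> unbounded_family (f ` I)"
    unfolding bounding_number_def by (rule card_less_min_card_imp_not)
  then show ?thesis by (auto simp: unbounded_family_def)
qed

lemma card_less_splitting_number_imp_unsplit:
  fixes A :: "'i \<Rightarrow> nat set"
  assumes "|I| <o splitting_number"
  shows "\<exists>a. infinite a \<and> (\<forall>i\<in>I. finite (a \<inter> A i) \<or> finite (a - A i))"
proof -
  let ?S = "{s \<in> A ` I. infinite s}"
  have "|?S| \<le>o |A ` I|" by (rule card_of_mono1) blast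
  then have "|?S| <o splitting_number" using card_of_image assms ordLeq_ordLess_trans by meson
  then have "\<not> splitting_family ?S"
    unfolding splitting_number_def by (rule card_less_min_card_imp_not)
  then obtain a where a: "infinite a" "\<forall>s\<in>?S. finite (a \<inter> s) \<or> finite (a - s)"
    unfolding splitting_family_def by blast
  have "finite (a \<inter> A i) \<or> finite (a - A i)" if "i \<in> I" for i
    using a(2) that by (cases "finite (A i)") auto
  then show ?thesis using a(1) by blast
qed

lemma unbounded_family_exists: "\<exists>F. unbounded_family F"
proof -
  have "\<not> le_star (\<lambda>n. Suc (g n)) g" for g
    by (auto simp: le_star_def eventually_sequentially)
  then show ?thesis unfolding unbounded_family_def by (meson UNIV_I)
qed

lemma splitting_family_exists: "\<exists>S. splitting_family S"
proof -
  have "splitting_family {s. infinite s}"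
    unfolding splitting_family_def
  proof (intro conjI ballI allI impI)
    fix a :: "nat set" assume "infinite a"
    then obtain b where "b \<subseteq> a" "infinite b" "infinite (a - b)"
      using infinite_coinfinite_subset by blast
    then show "\<exists>s\<in>{s. infinite s}. infinite (a \<inter> s) \<and> infinite (a - s)"
      by (intro bexI[of _ b]) (auto simp: Int_absorb1)
  qed auto
  then show ?thesis ..
qed

lemma finite_subset_star_chain_has_least:
  assumes "finite T" "T \<noteq> {}" "\<forall>s\<in>T. \<forall>t\<in>T. subset_star s t \<or> subset_star t s"
  shows "\<exists>m\<in>T. \<forall>t\<in>T. subset_star m t"
  using assms
proof (induction T rule: finite_ne_induct)
  case (singleton x)
  then show ?case by simp
next
  case (insert x F)
  then obtain m where m: "m \<in> F" "\<forall>t\<in>F. subset_star m t" by blast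
  show ?case
  proof (cases "subset_star m x")
    case True
    then show ?thesis using m by blast
  next
    case False
    then have "subset_star x m" using insert.prems m(1) by blast
    moreover have "subset_star x x" by (simp add: subset_star_def)
    ultimately have "\<forall>t\<in>insert x F. subset_star x t"
      using m(2) subset_star_trans by blast
    then show ?thesis by blast
  qed
qed

text \<open>A nonempty finite chain has a member almost contained in all others, which is a
  pseudo-intersection; for the empty family the set of all naturals is one.\<close>

lemma tower_infinite:
  assumes "tower T"
  shows "infinite T"
proof
  assume "finite T"
  have "\<exists>a. pseudo_intersection a T"
  proof (cases "T = {}")
    case True
    then show ?thesis using infinite_UNIV_nat by (auto simp: pseudo_intersection_def)
  next
    case False
    with \<open>finite T\<close> obtain m where "m \<in> T" "\<forall>t\<in>T. subset_star m t"
      using finite_subset_star_chain_has_least assms by (metis tower_def)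
    then show ?thesis using assms by (auto simp: pseudo_intersection_def tower_def)
  qed
  then show False using assms by (auto simp: tower_def)
qed

text \<open>For each \<open>s\<close> the infinite sets not split by \<open>s\<close> are open and
  dense: keep \<open>a\<close> or pass to \<open>a \<inter> s\<close>. The inequality later allows a
  tower to be paired with a splitting family without exceeding s.\<close>

lemma tower_number_le_splitting_number: "tower_number \<le>o splitting_number"
proof -
  obtain S where S: "splitting_family S" "|S| =o splitting_number"
    using splitting_family_exists min_card_witness unfolding splitting_number_def by metis
  have "\<not> |S| <o tower_number"
  proof
    assume "|S| <o tower_number"
    then have "\<exists>a. infinite a \<and> (\<forall>s\<in>S. finite (a \<inter> s) \<or> finite (a - s))"
    proof (rule tower_number_dense)
      fix s a b :: "nat set" assume *: "finite (a \<inter> s) \<or> finite (a - s)" "subset_star b a"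
      have "b \<inter> s \<subseteq> (a \<inter> s) \<union> (b - a)" "b - s \<subseteq> (a - s) \<union> (b - a)" by blast+
      then show "finite (b \<inter> s) \<or> finite (b - s)"
        using * finite_subset unfolding subset_star_def by (metis finite_Un)
    next
      fix s a :: "nat set" assume a: "infinite a"
      show "\<exists>b\<subseteq>a. infinite b \<and> (finite (b \<inter> s) \<or> finite (b - s))"
      proof (cases "finite (a \<inter> s)")
        case True
        then show ?thesis using a by blast
      next
        case False
        then show ?thesis by (intro exI[of _ "a \<inter> s"]) (auto simp: Diff_eq Int_assoc)
      qed
    qed
    then show False using S(1) unfolding splitting_family_def by blast
  qed
  moreover have "Card_order tower_number"
    unfolding tower_number_def using tower_exists Card_order_min_card by metis
  ultimately have "tower_number \<le>o |S|"
    by (metis card_of_Well_order card_order_on_well_order_on not_ordLeq_iff_ordLess)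
  then show ?thesis using S(2) ordLeq_ordIso_trans by blast
qed

lemma Card_order_tower_number: "Card_order tower_number"
  unfolding tower_number_def using tower_exists Card_order_min_card by metis

lemma Card_order_bounding_number: "Card_order bounding_number"
  unfolding bounding_number_def using unbounded_family_exists Card_order_min_card by metis

lemma Card_order_splitting_number: "Card_order splitting_number"
  unfolding splitting_number_def using splitting_family_exists Card_order_min_card by metis

lemma not_card_less_Card_order_iff:
  assumes "Card_order r"
  shows "\<not> |A| <o r \<longleftrightarrow> r \<le>o |A|"
  using assms by (metis card_of_Well_order card_order_on_well_order_on not_ordLess_iff_ordLeq)

lemma tower_witness: obtains T where "tower T" "|T| =o tower_number"
  using tower_exists min_card_witness unfolding tower_number_def by metis

lemma infinite_if_tower_number_le:
  assumes "tower_number \<le>o |A|"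
  shows "infinite A"
proof -
  obtain T where "tower T" "|T| =o tower_number" by (rule tower_witness)
  then have "|T| \<le>o |A|" using assms ordIso_ordLeq_trans by blast
  then show ?thesis using tower_infinite[OF \<open>tower T\<close>] card_of_ordLeq_infinite by blast
qed

lemma unbounded_family_infinite:
  assumes "unbounded_family F"
  shows "infinite F"
proof -
  have "\<not> |F| <o tower_number"
    using card_less_tower_number_imp_bounded[of F "\<lambda>f. f"] assms
    by (auto simp: unbounded_family_def)
  then show ?thesis
    using infinite_if_tower_number_le not_card_less_Card_order_iff Card_order_tower_number by blast
qed

section \<open>Cardinal arithmetic for the families of points\<close>

lemma finite_card_le_infinite:
  assumes "infinite B" "finite A"
  shows "|A| \<le>o |B|"
proof -
  have "\<not> |B| \<le>o |A|" using assms card_of_ordLeq_finite by blast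
  then show ?thesis using card_of_Well_order not_ordLeq_iff_ordLess ordLess_imp_ordLeq by metis
qed

lemma card_of_Un_le_infinite:
  assumes "infinite C" "|A| \<le>o |C|" "|B| \<le>o |C|"
  shows "|A \<union> B| \<le>o |C|"
  by (rule card_of_Un_ordLeq_infinite_Field[OF _ assms(2,3) card_of_Card_order])
    (simp only: Field_card_of assms(1) not_False_eq_True)

text \<open>The families of points used below consist of matrices given by pairs of parameters and
  of countably many complements of singletons; an infinite \<open>B\<close> absorbs both.\<close>

lemma card_of_set_family_le:
  fixes c :: "nat \<times> nat \<Rightarrow> 'p"
  assumes B: "infinite B" and I: "|I| \<le>o |B|" and J: "|J| \<le>o |B|"
  shows "|h ` (I \<times> J) \<union> range c| \<le>o |B|"
proof (rule card_of_Un_le_infinite[OF B])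
  have "|I \<times> J| \<le>o |B|"
    by (rule card_of_Times_ordLeq_infinite_Field[OF _ I J card_of_Card_order])
      (simp only: Field_card_of B not_False_eq_True)
  then show "|h ` (I \<times> J)| \<le>o |B|" using card_of_image ordLeq_transitive by blast
  have "|UNIV :: (nat \<times> nat) set| \<le>o |UNIV :: nat set|"
    by (rule card_of_ordLeqI[OF inj_to_nat]) simp
  then have "|range c| \<le>o |UNIV :: nat set|" using card_of_image ordLeq_transitive by blast
  then show "|range c| \<le>o |B|" using B infinite_iff_card_of_nat ordLeq_transitive by blast
qed

lemma card_of_nat_prod_sets_le_reals: "|UNIV :: (nat \<times> nat) set set| \<le>o |UNIV :: real set|"
proof -
  obtain g :: "nat set \<Rightarrow> real" where "inj g"
    using nat_sets_eqpoll_reals unfolding eqpoll_def bij_betw_def by blast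
  moreover have "inj (image (to_nat :: nat \<times> nat \<Rightarrow> nat))"
    by (rule injI) (simp add: inj_image_eq_iff)
  ultimately have "inj (g \<circ> image to_nat :: (nat \<times> nat) set \<Rightarrow> real)" by (rule inj_compose)
  then show ?thesis by (intro card_of_ordLeqI) auto
qed

lemma card_of_nat_prod_sets_le:
  fixes P :: "(nat \<times> nat) set set"
  assumes "|UNIV :: real set| \<le>o |UNIV :: 'a set|"
  shows "|P| \<le>o |UNIV :: 'a set|"
  using card_of_mono1[OF subset_UNIV] card_of_nat_prod_sets_le_reals assms ordLeq_transitive
  by metis

section \<open>Selections for few points\<close>

text \<open>Every \<open>F n\<close> is finite and every set lies in finitely many
  \<open>F n\<close>, so counting indices \<open>n\<close> can replace counting members of the
  cover.\<close>

lemma tau_cover_UN_finite: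
  assumes U: "\<And>n. tau_cover X (U n)"
    and F: "\<And>n. finite (F n)" "\<And>n. F n \<subseteq> U n"
    and few: "\<And>W. finite {n. W \<in> F n}"
    and many: "\<And>x. x \<in> topspace X \<Longrightarrow> infinite {n. \<exists>W\<in>F n. x \<in> W}"
    and comp: "\<And>x y. x \<in> topspace X \<Longrightarrow> y \<in> topspace X \<Longrightarrow>
      finite {n. \<exists>W\<in>F n. x \<in> W \<and> y \<notin> W} \<or> finite {n. \<exists>W\<in>F n. y \<in> W \<and> x \<notin> W}"
  shows "tau_cover X (\<Union>n. F n)"
proof -
  have inf: "infinite {W \<in> (\<Union>n. F n). x \<in> W}" if "x \<in> topspace X" for x
  proof
    assume "finite {W \<in> (\<Union>n. F n). x \<in> W}"
    then have "finite (\<Union>W\<in>{W \<in> (\<Union>n. F n). x \<in> W}. {n. W \<in> F n})"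
      using few by blast
    then have "finite {n. \<exists>W\<in>F n. x \<in> W}" by (rule rev_finite_subset) auto
    then show False using many[OF that] by blast
  qed
  have fin: "finite {W \<in> (\<Union>n. F n). x \<in> W \<and> y \<notin> W}"
    if "finite {n. \<exists>W\<in>F n. x \<in> W \<and> y \<notin> W}" for x y
  proof -
    have "finite (\<Union>n\<in>{n. \<exists>W\<in>F n. x \<in> W \<and> y \<notin> W}. F n)" using that F(1) by blast
    then show ?thesis by (rule rev_finite_subset) auto
  qed
  have sub: "W \<subseteq> topspace X" "W \<noteq> topspace X" if "W \<in> F n" for W n
    using that U[of n] F(2)[of n] unfolding tau_cover_def is_cover_def by blast+
  have "x \<in> \<Union>(\<Union>n. F n)" if "x \<in> topspace X" for x
    using infinite_imp_nonempty[OF inf[OF that]] by blast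
  then have "is_cover X (\<Union>n. F n)" unfolding is_cover_def using sub by blast
  then show ?thesis unfolding tau_cover_def using inf fin comp by blast
qed

lemma tau_cover_infinite:
  assumes "tau_cover X U" "topspace X \<noteq> {}"
  shows "infinite U"
proof -
  obtain x where "x \<in> topspace X" using assms(2) by blast
  then have "infinite {W\<in>U. x \<in> W}" using assms(1) by (simp add: tau_cover_def)
  then show ?thesis by (rule contrapos_nn) simp
qed

text \<open>The bound \<open>l\<close> makes every selection that takes only members of index at least \<open>l n\<close>
  from the \<open>n\<close>-th cover use each set finitely often.\<close>

lemma tau_covers_enumeration:
  fixes U :: "nat \<Rightarrow> 'a set set"
  assumes U: "\<And>n. countable (U n)" "\<And>n. tau_cover X (U n)" and ne: "topspace X \<noteq> {}"
  shows "\<exists>(V :: nat \<Rightarrow> nat \<Rightarrow> 'a set) l :: nat \<Rightarrow> nat.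
    (\<forall>n m. V n m \<in> U n) \<and>
    (\<forall>n. \<forall>x\<in>topspace X. infinite {m. x \<in> V n m}) \<and>
    (\<forall>n. \<forall>x\<in>topspace X. \<forall>y\<in>topspace X.
       finite {m. x \<in> V n m \<and> y \<notin> V n m} \<or> finite {m. y \<in> V n m \<and> x \<notin> V n m}) \<and>
    (\<forall>W. finite {n. \<exists>m\<ge>l n. V n m = W})"
proof -
  \<comment> \<open>The covers are countably infinite, so the enumerations are bijective and
    finiteness can be read off indices.\<close>
  define V where "V n = from_nat_into (U n)" for n
  have bij: "bij_betw (V n) UNIV (U n)" for n
    unfolding V_def using U(1) tau_cover_infinite[OF U(2) ne] by (rule bij_betw_from_nat_into)
  have VU: "V n m \<in> U n" and inj: "inj (V n)" for n m
    using bij[of n] by (blast dest: bij_betwE bij_betw_imp_inj_on)+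
  have fin_iff: "finite {m. P (V n m)} \<longleftrightarrow> finite {W\<in>U n. P W}" for n P
  proof -
    have "V n ` {m. P (V n m)} = {W\<in>range (V n). P W}" by blast
    also have "range (V n) = U n" using bij by (rule bij_betw_imp_surj_on)
    finally have "V n ` {m. P (V n m)} = {W\<in>U n. P W}" .
    moreover have "finite (V n ` {m. P (V n m)}) \<longleftrightarrow> finite {m. P (V n m)}"
      using inj_on_subset[OF inj subset_UNIV] by (rule finite_image_iff)
    ultimately show ?thesis by simp
  qed
  \<comment> \<open>\<open>idx\<close> numbers the members of all covers at once. With
    \<open>l n\<close> beyond all positions in row \<open>n\<close> of sets numbered at most
    \<open>n\<close>, a set \<open>W\<close> can be selected only in rows
    \<open>n < idx W\<close>.\<close>
  define idx where "idx = to_nat_on (\<Union>n. U n)"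
  have inj_on: "inj_on idx (\<Union>n. U n)" 
    unfolding idx_def by (intro inj_on_to_nat_on countable_UN U(1)) simp
  have inj_idx: "inj (\<lambda>m. idx (V n m))" for n
  proof (rule injI)
    fix p q assume "idx (V n p) = idx (V n q)"
    then have "V n p = V n q" using VU by (intro inj_onD[OF inj_on]) auto
    then show "p = q" using inj by (simp add: inj_eq)
  qed
  have "\<exists>l. \<forall>m. idx (V n m) \<le> n \<longrightarrow> m < l" for n
  proof -
    have "finite ((\<lambda>m. idx (V n m)) -` {..n})"
      using inj_idx by (intro finite_vimageI) auto
    then show ?thesis by (auto simp: finite_nat_set_iff_bounded)
  qed
  then obtain l where l: "\<And>n m. idx (V n m) \<le> n \<Longrightarrow> m < l n" by metis
  have few: "finite {n. \<exists>m\<ge>l n. V n m = W}" for W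
  proof (rule finite_subset)
    show "{n. \<exists>m\<ge>l n. V n m = W} \<subseteq> {..<idx W}"
    proof
      fix n assume "n \<in> {n. \<exists>m\<ge>l n. V n m = W}"
      then obtain m where m: "l n \<le> m" "V n m = W" by blast
      then have "\<not> idx (V n m) \<le> n" using l[of n m] by linarith
      then show "n \<in> {..<idx W}" using m(2) by simp
    qed
  qed simp
  show ?thesis
  proof (intro exI[of _ V] exI[of _ l] conjI allI ballI)
    show "infinite {m. x \<in> V n m}" if "x \<in> topspace X" for n x
      using U(2)[of n] that fin_iff[where n = n and P = "\<lambda>W. x \<in> W"] by (simp add: tau_cover_def)
    show "finite {m. x \<in> V n m \<and> y \<notin> V n m} \<or> finite {m. y \<in> V n m \<and> x \<notin> V n m}"
      if "x \<in> topspace X" "y \<in> topspace X" for n x y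
      using U(2)[of n] that fin_iff[where n = n and P = "\<lambda>W. x \<in> W \<and> y \<notin> W"]
        fin_iff[where n = n and P = "\<lambda>W. y \<in> W \<and> x \<notin> W"]
      by (simp add: tau_cover_def)
  qed (rule VU few)+
qed

lemma finite_Collect_nat_bound:
  assumes "finite {m::nat. P m}"
  shows "\<exists>k. \<forall>m\<ge>k. \<not> P m"
  using assms by (metis finite_nat_set_iff_bounded mem_Collect_eq not_le)

text \<open>The selection is so good that every point lies in all but finitely many of the sets,
  which leaves only finitely many \<open>n\<close> to separate any two points.\<close>

lemma tau_cover_selection_S1:
  fixes U :: "nat \<Rightarrow> 'a set set"
  assumes "|topspace X| <o tower_number" and ne: "topspace X \<noteq> {}"
    and U: "\<And>n. countable (U n)" "\<And>n. tau_cover X (U n)"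
  shows "\<exists>W. (\<forall>n. W n \<in> U n) \<and> tau_cover X (range W)"
proof -
  obtain V :: "nat \<Rightarrow> nat \<Rightarrow> 'a set" and l where VU: "\<And>n m. V n m \<in> U n"
    and inf: "\<And>n x. x \<in> topspace X \<Longrightarrow> infinite {m. x \<in> V n m}"
    and comp: "\<And>n x y. x \<in> topspace X \<Longrightarrow> y \<in> topspace X \<Longrightarrow>
       finite {m. x \<in> V n m \<and> y \<notin> V n m} \<or> finite {m. y \<in> V n m \<and> x \<notin> V n m}"
    and few: "\<And>W. finite {n. \<exists>m\<ge>l n. V n m = W}"
    using tau_covers_enumeration[of U X, OF U ne] by blast
  have "\<exists>a. infinite a \<and> (\<forall>x\<in>topspace X. subset_star a {m. x \<in> V n m})" for n
    using assms(1)
  proof (rule pseudo_intersection_exists)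
    show "infinite {m. x \<in> V n m}" if "x \<in> topspace X" for x using inf that .
    show "subset_star {m. x \<in> V n m} {m. y \<in> V n m} \<or> subset_star {m. y \<in> V n m} {m. x \<in> V n m}"
      if "x \<in> topspace X" "y \<in> topspace X" for x y
      using comp[OF that, of n] by (simp add: subset_star_def set_diff_eq)
  qed
  then obtain a where a: "\<And>n. infinite (a n)"
    "\<And>n x. x \<in> topspace X \<Longrightarrow> finite (a n - {m. x \<in> V n m})"
    unfolding subset_star_def by metis
  have "\<exists>k. \<forall>m\<ge>k. m \<in> a n \<longrightarrow> x \<in> V n m" if "x \<in> topspace X" for n x
  proof -
    have "finite {m. m \<in> a n \<and> x \<notin> V n m}" using a(2)[OF that, of n] by (simp add: set_diff_eq)
    then show ?thesis using finite_Collect_nat_bound by fastforce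
  qed
  \<comment> \<open>\<open>f x n\<close> is a place from which on \<open>a n\<close> lies inside row
    \<open>n\<close> of \<open>x\<close>; one \<open>g\<close> dominates all these
    functions.\<close>
  then obtain f where f: "\<And>x n m. x \<in> topspace X \<Longrightarrow> m \<ge> f x n \<Longrightarrow> m \<in> a n \<Longrightarrow> x \<in> V n m"
    by metis
  obtain g where g: "\<And>x. x \<in> topspace X \<Longrightarrow> le_star (f x) g"
    using card_less_tower_number_imp_bounded[OF assms(1), of f] by blast
  have "\<exists>k. k \<in> a n \<and> max (g n) (l n) \<le> k" for n
    using a(1)[of n] by (meson infinite_nat_iff_unbounded_le)
  then obtain k where k: "\<And>n. k n \<in> a n" "\<And>n. g n \<le> k n" "\<And>n. l n \<le> k n"
    by (metis max.boundedE)
  have ev: "\<exists>N. \<forall>n\<ge>N. x \<in> V n (k n)" if "x \<in> topspace X" for x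
    using g[OF that] f[OF that] k unfolding le_star_def eventually_sequentially
    by (meson le_trans)
  let ?W = "\<lambda>n. V n (k n)"
  have "tau_cover X (\<Union>n. {?W n})"
  proof (rule tau_cover_UN_finite[OF U(2)])
    show "finite {n. W \<in> {?W n}}" for W
      by (rule finite_subset[OF _ few[of W]]) (use k(3) in auto)
    show "infinite {n. \<exists>W\<in>{?W n}. x \<in> W}" if x: "x \<in> topspace X" for x
    proof -
      obtain N where "\<forall>n\<ge>N. x \<in> ?W n" using ev[OF x] by blast
      then have "{N..} \<subseteq> {n. \<exists>W\<in>{?W n}. x \<in> W}" by auto
      then show ?thesis using infinite_Ici finite_subset by blast
    qed
    show "finite {n. \<exists>W\<in>{?W n}. x \<in> W \<and> y \<notin> W} \<or> finite {n. \<exists>W\<in>{?W n}. y \<in> W \<and> x \<notin> W}"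
      if x: "x \<in> topspace X" and y: "y \<in> topspace X" for x y
    proof -
      obtain N where N: "\<forall>n\<ge>N. y \<in> ?W n" using ev[OF y] by blast
      have "{n. \<exists>W\<in>{?W n}. x \<in> W \<and> y \<notin> W} \<subseteq> {..<N}"
        using N by clarsimp (metis not_le)
      then show ?thesis using finite_subset by blast
    qed
  qed (use VU in auto)
  moreover have "(\<Union>n. {?W n}) = range ?W" by auto
  ultimately show ?thesis using VU by metis
qed

lemma tau_cover_selection_Sfin:
  fixes U :: "nat \<Rightarrow> 'a set set"
  assumes s: "|topspace X| <o splitting_number" and b: "|topspace X| <o bounding_number"
    and infX: "infinite (topspace X)"
    and U: "\<And>n. countable (U n)" "\<And>n. tau_cover X (U n)"
  shows "\<exists>F. (\<forall>n. finite (F n) \<and> F n \<subseteq> U n) \<and> tau_cover X (\<Union>n. F n)"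
proof -
  have ne: "topspace X \<noteq> {}" using infX by auto
  obtain V :: "nat \<Rightarrow> nat \<Rightarrow> 'a set" and l where VU: "\<And>n m. V n m \<in> U n"
    and inf: "\<And>n x. x \<in> topspace X \<Longrightarrow> infinite {m. x \<in> V n m}"
    and comp: "\<And>n x y. x \<in> topspace X \<Longrightarrow> y \<in> topspace X \<Longrightarrow>
       finite {m. x \<in> V n m \<and> y \<notin> V n m} \<or> finite {m. y \<in> V n m \<and> x \<notin> V n m}"
    and few: "\<And>W. finite {n. \<exists>m\<ge>l n. V n m = W}"
    using tau_covers_enumeration[of U X, OF U ne] by blast
  \<comment> \<open>Comparability concerns pairs of points, and an infinite space has as many pairs
    as points.\<close>
  let ?X2 = "topspace X \<times> topspace X"
  have "|?X2| =o |topspace X|" by (rule card_of_Times_same_infinite[OF infX])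
  then have s2: "|?X2| <o splitting_number" and b2: "|?X2| <o bounding_number"
    using s b ordIso_ordLess_trans by blast+
  \<comment> \<open>\<open>E (x, y)\<close> collects the rows in which \<open>x\<close> is almost
    contained in \<open>y\<close>; some infinite set \<open>a\<close> of rows is split by none of
    these sets.\<close>
  define E where "E = (\<lambda>(x, y). {n. finite {m. x \<in> V n m \<and> y \<notin> V n m}})"
  obtain a where a: "infinite a" "\<And>p. p \<in> ?X2 \<Longrightarrow> finite (a \<inter> E p) \<or> finite (a - E p)"
    using card_less_splitting_number_imp_unsplit[OF s2, of E] by blast
  have aE: "finite (a - E (x, y)) \<or> finite (a - E (y, x))"
    if "x \<in> topspace X" "y \<in> topspace X" for x y
  proof -
    \<comment> \<open>In every row one of the two almost inclusions holds, so a row outside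
      \<open>E (y, x)\<close> lies in \<open>E (x, y)\<close>.\<close>
    have "a - E (y, x) \<subseteq> a \<inter> E (x, y)" using comp[OF that] by (auto simp: E_def)
    then have "finite (a - E (y, x))" if "finite (a \<inter> E (x, y))" using that by (rule finite_subset)
    then show ?thesis using a(2)[of "(x, y)"] that by blast
  qed
  have "\<exists>f. \<forall>n\<in>E p. \<forall>m\<ge>f n. fst p \<in> V n m \<longrightarrow> snd p \<in> V n m" for p
  proof -
    have "\<forall>n\<in>E p. \<exists>k. \<forall>m\<ge>k. fst p \<in> V n m \<longrightarrow> snd p \<in> V n m"
      using finite_Collect_nat_bound by (fastforce simp: E_def split: prod.splits)
    then show ?thesis by metis
  qed
  then obtain f where f: "\<And>p n m. n \<in> E p \<Longrightarrow> m \<ge> f p n \<Longrightarrow> fst p \<in> V n m \<Longrightarrow> snd p \<in> V n m"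
    by metis
  obtain g0 where g0: "\<And>p. p \<in> ?X2 \<Longrightarrow> le_star (f p) g0"
    using card_less_bounding_number_imp_bounded[OF b2, of f] by blast
  define g where "g n = max (g0 n) (l n)" for n
  \<comment> \<open>The lower ends \<open>g n\<close> are fixed first, to lie beyond the exceptions
    to the almost inclusions. Then \<open>c x n\<close> picks an element of row \<open>n\<close> of
    \<open>x\<close> above \<open>g n\<close>, and an \<open>h\<close> dominating all
    \<open>c x\<close> gives the upper ends.\<close>
  have "\<exists>m. m \<ge> g n \<and> x \<in> V n m" if "x \<in> topspace X" for x n
    using inf[OF that, of n] by (metis infinite_nat_iff_unbounded_le mem_Collect_eq)
  then obtain c where c: "\<And>x n. x \<in> topspace X \<Longrightarrow> c x n \<ge> g n \<and> x \<in> V n (c x n)" by metis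
  obtain h where h: "\<And>x. x \<in> topspace X \<Longrightarrow> le_star (c x) h"
    using card_less_bounding_number_imp_bounded[OF b, of c] by blast
  define F where "F n = (if n \<in> a then V n ` {g n..h n} else {})" for n
  have "tau_cover X (\<Union>n. F n)"
  proof (rule tau_cover_UN_finite[OF U(2)])
    show "finite {n. W \<in> F n}" for W
      by (rule finite_subset[OF _ few[of W]]) (auto simp: F_def g_def split: if_splits)
    show "infinite {n. \<exists>W\<in>F n. x \<in> W}" if x: "x \<in> topspace X" for x
    proof -
      obtain N where N: "\<forall>n\<ge>N. c x n \<le> h n"
        using h[OF x] by (auto simp: le_star_def eventually_sequentially)
      have "infinite (a - {..<N})" using a(1) by simp
      moreover have "a - {..<N} \<subseteq> {n. \<exists>W\<in>F n. x \<in> W}"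
        using c[OF x] N by (auto simp: F_def not_less intro!: bexI[of _ "c x _"])
      ultimately show ?thesis using finite_subset by blast
    qed
    have fin: "finite {n. \<exists>W\<in>F n. x \<in> W \<and> y \<notin> W}"
      if x: "x \<in> topspace X" and y: "y \<in> topspace X" and E: "finite (a - E (x, y))" for x y
    proof -
      obtain N where N: "\<forall>n\<ge>N. f (x, y) n \<le> g0 n"
        using g0[of "(x, y)"] x y by (auto simp: le_star_def eventually_sequentially)
      have "{n. \<exists>W\<in>F n. x \<in> W \<and> y \<notin> W} \<subseteq> (a - E (x, y)) \<union> {..<N}"
      proof
        fix n assume "n \<in> {n. \<exists>W\<in>F n. x \<in> W \<and> y \<notin> W}"
        then obtain m where m: "n \<in> a" "g n \<le> m" "x \<in> V n m" "y \<notin> V n m"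
          by (auto simp: F_def split: if_splits)
        then show "n \<in> (a - E (x, y)) \<union> {..<N}"
          using f[of n "(x, y)" m] N[rule_format, of n] by (cases "N \<le> n") (auto simp: g_def)
      qed
      then show ?thesis using E finite_subset by blast
    qed
    then show "finite {n. \<exists>W\<in>F n. x \<in> W \<and> y \<notin> W} \<or> finite {n. \<exists>W\<in>F n. y \<in> W \<and> x \<notin> W}"
      if "x \<in> topspace X" "y \<in> topspace X" for x y
      using aE[OF that] that by blast
  qed (use VU in \<open>auto simp: F_def\<close>)
  moreover have "finite (F n) \<and> F n \<subseteq> U n" for n using VU by (auto simp: F_def)
  ultimately show ?thesis by blast
qed

section \<open>Spaces of subsets of a countable set\<close>

text \<open>Basic open boxes restrict finitely many coordinates, and they are also closed because
  the naturals are discrete.\<close>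

lemma dim_le_0_nat_functions: "(euclidean :: ('k \<Rightarrow> nat) topology) dim_le 0"
  unfolding dimension_le_0_neighbourhood_base_of_clopen
proof (subst open_neighbourhood_base_of)
  show "\<forall>(W :: ('k \<Rightarrow> nat) set) x. openin euclidean W \<and> x \<in> W \<longrightarrow>
      (\<exists>U. (closedin euclidean U \<and> openin euclidean U) \<and> x \<in> U \<and> U \<subseteq> W)"
  proof (intro allI impI)
    fix W and x :: "'k \<Rightarrow> nat"
    assume "openin euclidean W \<and> x \<in> W"
    then have "openin (product_topology (\<lambda>i. euclidean) UNIV) W" "x \<in> W"
      by (simp_all add: euclidean_product_topology)
    then obtain Y where Y: "x \<in> Pi\<^sub>E UNIV Y" "finite {i. Y i \<noteq> UNIV}" "Pi\<^sub>E UNIV Y \<subseteq> W"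
      using product_topology_open_contains_basis[of "\<lambda>i. euclidean" UNIV W x] by auto
    have "Pi\<^sub>E UNIV Y = (\<Inter>i. (\<lambda>f. f i) -` Y i)" by (auto simp: PiE_def Pi_def)
    moreover have "closed ((\<lambda>f. f i) -` Y i)" for i
      by (rule closed_vimage) (simp_all add: closed_def open_discrete)
    ultimately have "closed (Pi\<^sub>E UNIV Y)" by (simp add: closed_INT)
    moreover have "open (Pi\<^sub>E UNIV Y)" using Y(2) by (intro open_PiE) (simp_all add: open_discrete)
    ultimately show "\<exists>U. (closedin euclidean U \<and> openin euclidean U) \<and> x \<in> U \<and> U \<subseteq> W"
      using Y by (intro exI[of _ "Pi\<^sub>E UNIV Y"] conjI) (simp_all flip: closed_closedin)
  qed
qed auto

lemma metrizable_space_nat_functions: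
  "metrizable_space (euclidean :: ('k::countable \<Rightarrow> nat) topology)"
proof -
  have "(euclidean :: nat topology) = discrete_topology UNIV"
    by (simp add: topology_eq open_discrete flip: open_openin)
  then have "metrizable_space (product_topology (\<lambda>i::'k. euclidean :: nat topology) UNIV)"
    by (simp add: metrizable_space_product_topology)
  then show ?thesis by (simp add: euclidean_product_topology)
qed

text \<open>The characteristic functions of the \<open>C k\<close> embed \<open>A\<close> into a
  countable power of the naturals. The topology is pulled back along this embedding, so that each
  \<open>C k\<close> becomes the preimage of a coordinate condition.\<close>

lemma set_of_reals_with_clopen_sets:
  fixes A :: "'a set" and C :: "'k::countable \<Rightarrow> 'a set"
  assumes A: "infinite A" and C: "\<And>k. C k \<subseteq> A"
    and sep: "\<And>x y. x \<in> A \<Longrightarrow> y \<in> A \<Longrightarrow> (\<And>k. x \<in> C k \<longleftrightarrow> y \<in> C k) \<Longrightarrow> x = y"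
  shows "\<exists>X. topspace X = A \<and> set_of_reals X \<and> (\<forall>k. openin X (C k) \<and> closedin X (C k))"
proof -
  define e :: "'a \<Rightarrow> 'k \<Rightarrow> nat" where "e = (\<lambda>x k. if x \<in> C k then 1 else 0)"
  define X where "X = pullback_topology A e euclidean"
  define Y where "Y = top_of_set (e ` A)"
  have top: "topspace X = A" by (simp add: X_def topspace_pullback_topology)
  have openX: "openin X S \<longleftrightarrow> (\<exists>U. open U \<and> S = e -` U \<inter> A)" for S
    by (simp add: X_def openin_pullback_topology flip: open_openin)
  have inj: "inj_on e A"
  proof (rule inj_onI)
    fix x y assume "x \<in> A" "y \<in> A" "e x = e y"
    have "x \<in> C k \<longleftrightarrow> y \<in> C k" for k
      using fun_cong[OF \<open>e x = e y\<close>, of k] by (simp add: e_def split: if_splits)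
    with \<open>x \<in> A\<close> \<open>y \<in> A\<close> show "x = y" by (rule sep)
  qed
  have "homeomorphic_map X Y e"
  proof (rule bijective_open_imp_homeomorphic_map)
    show "continuous_map X Y e"
      unfolding continuous_map_def Y_def
    proof (intro conjI allI impI)
      fix U assume "openin (top_of_set (e ` A)) U"
      then obtain V where "open V" "U = e ` A \<inter> V" by (auto simp: openin_open)
      then show "openin X {x \<in> topspace X. e x \<in> U}"
        unfolding openX top by (auto intro!: exI[of _ V])
    qed (simp add: top)
    show "open_map X Y e"
      unfolding open_map_def openX Y_def
    proof (intro allI impI)
      fix S assume "\<exists>U. open U \<and> S = e -` U \<inter> A"
      then obtain U where "open U" "S = e -` U \<inter> A" by blast
      then have "e ` S = e ` A \<inter> U" by auto
      with \<open>open U\<close> show "openin (top_of_set (e ` A)) (e ` S)" by (auto simp: openin_open)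
    qed
  qed (simp_all add: top Y_def inj)
  then have homeo: "X homeomorphic_space Y" by (rule homeomorphic_map_imp_homeomorphic_space)
  \<comment> \<open>Separability of the subspace comes from second countability, which is
    hereditary.\<close>
  have "second_countable (euclidean :: ('k \<Rightarrow> nat) topology)"
  proof -
    obtain \<B> :: "('k \<Rightarrow> nat) set set" where "countable \<B>" "topological_basis \<B>"
      using ex_countable_basis by blast
    then show ?thesis
      unfolding second_countable_def open_openin[symmetric]
      by (intro exI[of _ \<B>]) (meson topological_basisE topological_basis_open)
  qed
  then have "separable_space Y"
    unfolding Y_def by (intro second_countable_imp_separable_space second_countable_subtopology)
  moreover have "metrizable_space Y"
    unfolding Y_def by (intro metrizable_space_subtopology metrizable_space_nat_functions)
  moreover have "Y dim_le 0"
    unfolding Y_def by (intro dimension_le_subtopology dim_le_0_nat_functions)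
  ultimately have "set_of_reals X"
    unfolding set_of_reals_def
    using A top homeomorphic_separable_space[OF homeo] homeomorphic_metrizable_space[OF homeo]
      homeomorphic_space_dimension_le[OF homeo, of 0] by simp
  moreover have "openin X (C k) \<and> closedin X (C k)" for k
  proof -
    have coord: "open ((\<lambda>f. f k) -` N)" for N :: "nat set"
      by (rule open_vimage) (simp_all add: open_discrete)
    have "C k = e -` ((\<lambda>f. f k) -` {1}) \<inter> A" "A - C k = e -` ((\<lambda>f. f k) -` {0}) \<inter> A"
      using C by (auto simp: e_def split: if_splits)
    then have "openin X (C k)" "openin X (A - C k)"
      unfolding openX using coord[of "{1}"] coord[of "{0}"] by blast+
    then show ?thesis using C by (simp add: closedin_def top)
  qed
  ultimately show ?thesis using top by blast
qed

text \<open>The \<tau>-cover conditions for the sets with index in \<open>G\<close>, where a point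
  is identified with the set \<open>p\<close> of the indices of the sets containing it.\<close>

definition tau_trace :: "'k set set \<Rightarrow> 'k set \<Rightarrow> bool" where
  "tau_trace P G \<longleftrightarrow> (\<forall>p\<in>P. infinite (G \<inter> p)) \<and>
     (\<forall>p\<in>P. \<forall>q\<in>P. finite (G \<inter> p - q) \<or> finite (G \<inter> q - p))"

text \<open>Points are subsets of \<open>'k\<close>, and the \<open>k\<close>-th set of the space consists of the points
  containing \<open>k\<close>. The points \<open>- {k}\<close> keep these sets distinct and different from the space.\<close>

lemma set_of_reals_from_set_family:
  fixes P :: "'k::countable set set"
  assumes card: "|P| \<le>o |UNIV :: 'a set|" and inf: "infinite (UNIV :: 'k set)"
    and cosing: "\<And>k. - {k} \<in> P"
  shows "\<exists>(X :: 'a topology) C. set_of_reals X \<and> |topspace X| \<le>o |P| \<and> inj C \<and>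
    (\<forall>k::'k. openin X (C k) \<and> closedin X (C k)) \<and>
    (\<forall>G. tau_cover X (C ` G) \<longleftrightarrow> tau_trace P G)"
proof -
  obtain \<phi> :: "'k set \<Rightarrow> 'a" where \<phi>: "inj_on \<phi> P"
    using card unfolding card_of_ordLeq[symmetric] by blast
  define C where "C k = \<phi> ` {p\<in>P. k \<in> p}" for k
  have mem: "\<phi> p \<in> C k \<longleftrightarrow> k \<in> p" if "p \<in> P" for p k
    using that inj_on_eq_iff[OF \<phi>] by (auto simp: C_def)
  have inj: "inj C"
  proof (rule injI)
    fix k l assume "C k = C l"
    then have "l \<in> - {k} \<longleftrightarrow> k \<in> - {k}" using mem[OF cosing[of k]] by blast
    then show "k = l" by simp
  qed
  have "inj (\<lambda>k::'k. - {k})" by (rule injI) simp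
  with inf have "infinite (range (\<lambda>k::'k. - {k}))" using finite_imageD by blast
  moreover have "range (\<lambda>k::'k. - {k}) \<subseteq> P" using cosing by blast
  ultimately have "infinite P" using finite_subset by blast
  then have "infinite (\<phi> ` P)" using \<phi> finite_imageD by blast
  moreover have "C k \<subseteq> \<phi> ` P" for k by (auto simp: C_def)
  moreover have "x = y"
    if xy: "x \<in> \<phi> ` P" "y \<in> \<phi> ` P" and eq: "\<And>k. x \<in> C k \<longleftrightarrow> y \<in> C k" for x y
  proof -
    obtain p q where pq: "p \<in> P" "x = \<phi> p" "q \<in> P" "y = \<phi> q" using xy by blast
    then have "k \<in> p \<longleftrightarrow> k \<in> q" for k using eq[of k] mem by blast
    then have "p = q" by blast
    then show ?thesis using pq by simp
  qed
  ultimately obtain X where X: "topspace X = \<phi> ` P" "set_of_reals X"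
      "\<And>k. openin X (C k) \<and> closedin X (C k)"
    using set_of_reals_with_clopen_sets[of "\<phi> ` P" C] by blast
  have sub: "finite {U \<in> C ` G. R U} \<longleftrightarrow> finite {k \<in> G. R (C k)}" for G R
  proof -
    have "{U \<in> C ` G. R U} = C ` {k \<in> G. R (C k)}" by blast
    then show ?thesis by (simp add: finite_image_iff inj_on_subset[OF inj])
  qed
  have memG: "finite {U \<in> C ` G. \<phi> p \<in> U} \<longleftrightarrow> finite (G \<inter> p)" if "p \<in> P" for p G
    unfolding sub[of G "\<lambda>U. \<phi> p \<in> U"] mem[OF that] by (simp add: Int_def)
  have diffG: "finite {U \<in> C ` G. \<phi> p \<in> U \<and> \<phi> q \<notin> U} \<longleftrightarrow> finite (G \<inter> p - q)"
    if "p \<in> P" "q \<in> P" for p q G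
  proof -
    have "{k \<in> G. k \<in> p \<and> k \<notin> q} = G \<inter> p - q" by blast
    then show ?thesis
      unfolding sub[of G "\<lambda>U. \<phi> p \<in> U \<and> \<phi> q \<notin> U"] mem[OF that(1)] mem[OF that(2)] by simp
  qed
  have "(\<forall>x\<in>\<phi> ` P. infinite {U \<in> C ` G. x \<in> U}) \<longleftrightarrow> (\<forall>p\<in>P. infinite (G \<inter> p))" for G
    using memG by blast
  moreover have "(\<forall>x\<in>\<phi> ` P. \<forall>y\<in>\<phi> ` P. finite {U \<in> C ` G. x \<in> U \<and> y \<notin> U} \<or>
      finite {U \<in> C ` G. y \<in> U \<and> x \<notin> U}) \<longleftrightarrow>
    (\<forall>p\<in>P. \<forall>q\<in>P. finite (G \<inter> p - q) \<or> finite (G \<inter> q - p))" for G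
    unfolding ball_simps by (intro ball_cong refl) (simp only: diffG)
  ultimately have tau: "tau_cover X (C ` G) \<longleftrightarrow> is_cover X (C ` G) \<and> tau_trace P G" for G
    unfolding tau_cover_def tau_trace_def X(1) by simp
  have "is_cover X (C ` G)" if "tau_trace P G" for G
  proof -
    have "\<phi> (- {k}) \<notin> C k" "\<phi> (- {k}) \<in> topspace X" for k
      using mem[OF cosing] cosing X(1) by auto
    then have "topspace X \<notin> C ` G" by blast
    moreover have "\<exists>k\<in>G. \<phi> p \<in> C k" if "p \<in> P" for p
    proof -
      have "G \<inter> p \<noteq> {}" using \<open>tau_trace P G\<close> that unfolding tau_trace_def by fastforce
      then show ?thesis using mem[OF that] by blast
    qed
    moreover have "C k \<subseteq> topspace X" for k using X(1) by (auto simp: C_def)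
    ultimately show ?thesis unfolding is_cover_def X(1) by blast
  qed
  moreover have "|topspace X| \<le>o |P|" unfolding X(1) by (rule card_of_image)
  ultimately show ?thesis using X(2,3) inj tau by blast
qed

lemma S1D:
  fixes U :: "nat \<Rightarrow> 'a set set"
  assumes "S1 \<A> \<B>" "\<And>n. U n \<in> \<A>"
  shows "\<exists>W. (\<forall>n. W n \<in> U n) \<and> range W \<in> \<B>"
  using assms unfolding S1_def by meson

lemma SfinD:
  fixes U :: "nat \<Rightarrow> 'a set set"
  assumes "Sfin \<A> \<B>" "\<And>n. U n \<in> \<A>"
  shows "\<exists>F. (\<forall>n. finite (F n) \<and> F n \<subseteq> U n) \<and> (\<Union>n. F n) \<in> \<B>"
  using assms unfolding Sfin_def by meson

text \<open>Row \<open>n\<close> of the index set provides the \<open>n\<close>-th cover, so that a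
  selection of one set from each cover is the graph of a function.\<close>

lemma not_S1_clopen_from_set_family:
  fixes P :: "(nat \<times> nat) set set"
  assumes card: "|P| \<le>o |UNIV :: 'a set|" and cosing: "\<And>k. - {k} \<in> P"
    and rows: "\<And>n. tau_trace P ({n} \<times> UNIV)"
    and no: "\<And>f. \<not> tau_trace P (range (\<lambda>n. (n, f n)))"
  shows "\<exists>X :: 'a topology. set_of_reals X \<and> |topspace X| \<le>o |P| \<and>
    \<not> S1 (clopen_tau_covers X) (clopen_tau_covers X)"
proof -
  obtain X :: "'a topology" and C where X: "set_of_reals X" "|topspace X| \<le>o |P|" "inj C"
    "\<forall>k. openin X (C k) \<and> closedin X (C k)"
    and tau: "\<And>G. tau_cover X (C ` G) \<longleftrightarrow> tau_trace P G"
    using set_of_reals_from_set_family[OF card _ cosing] by (auto simp: finite_prod)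
  have "\<not> S1 (clopen_tau_covers X) (clopen_tau_covers X)"
  proof
    assume S1: "S1 (clopen_tau_covers X) (clopen_tau_covers X)"
    have "C ` ({n} \<times> UNIV) \<in> clopen_tau_covers X" for n
      using X(4) rows[of n] tau by (auto simp: clopen_tau_covers_def)
    then obtain U where U: "\<And>n. U n \<in> C ` ({n} \<times> UNIV)" "range U \<in> clopen_tau_covers X"
      using S1D[OF S1, of "\<lambda>n. C ` ({n} \<times> UNIV)"] by blast
    then have "\<forall>n. \<exists>m. U n = C (n, m)" by blast
    then obtain f where "\<And>n. U n = C (n, f n)" by metis
    then have "range U = C ` range (\<lambda>n. (n, f n))" by auto
    then show False using U(2) tau no by (auto simp: clopen_tau_covers_def)
  qed
  then show ?thesis using X by blast
qed

lemma not_Sfin_clopen_from_set_family: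
  fixes P :: "(nat \<times> nat) set set"
  assumes card: "|P| \<le>o |UNIV :: 'a set|" and cosing: "\<And>k. - {k} \<in> P"
    and rows: "\<And>n. tau_trace P ({n} \<times> UNIV)"
    and no: "\<And>F. (\<And>n. finite (F n)) \<Longrightarrow> \<not> tau_trace P (Sigma UNIV F)"
  shows "\<exists>X :: 'a topology. set_of_reals X \<and> |topspace X| \<le>o |P| \<and>
    \<not> Sfin (clopen_tau_covers X) (clopen_tau_covers X)"
proof -
  obtain X :: "'a topology" and C where X: "set_of_reals X" "|topspace X| \<le>o |P|" "inj C"
    "\<forall>k. openin X (C k) \<and> closedin X (C k)"
    and tau: "\<And>G. tau_cover X (C ` G) \<longleftrightarrow> tau_trace P G"
    using set_of_reals_from_set_family[OF card _ cosing] by (auto simp: finite_prod)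
  have "\<not> Sfin (clopen_tau_covers X) (clopen_tau_covers X)"
  proof
    assume Sfin: "Sfin (clopen_tau_covers X) (clopen_tau_covers X)"
    have "C ` ({n} \<times> UNIV) \<in> clopen_tau_covers X" for n
      using X(4) rows[of n] tau by (auto simp: clopen_tau_covers_def)
    then obtain \<F> where F: "\<forall>n. finite (\<F> n) \<and> \<F> n \<subseteq> C ` ({n} \<times> UNIV)"
      "(\<Union>n. \<F> n) \<in> clopen_tau_covers X"
      using SfinD[OF Sfin, of "\<lambda>n. C ` ({n} \<times> UNIV)"] by meson
    \<comment> \<open>A finite selection from row \<open>n\<close> has finitely many indices because
      \<open>C\<close> is injective.\<close>
    define F where "F n = {m. C (n, m) \<in> \<F> n}" for n
    have eq: "\<F> n = (\<lambda>m. C (n, m)) ` F n" for n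
      using F(1)[rule_format, of n] by (auto simp: F_def)
    have "inj (\<lambda>m. C (n, m))" for n by (rule injI) (simp add: inj_eq[OF X(3)])
    then have "finite (F n)" for n
      using F(1)[rule_format, of n] unfolding eq
      by (meson finite_imageD inj_on_subset subset_UNIV)
    moreover have "(\<Union>n. \<F> n) = C ` Sigma UNIV F" unfolding eq by auto
    ultimately show False using F(2) tau no by (auto simp: clopen_tau_covers_def)
  qed
  then show ?thesis using X by blast
qed

section \<open>Spaces without good selections\<close>

lemma tau_trace_row_iff:
  "tau_trace P ({n} \<times> UNIV) \<longleftrightarrow> (\<forall>p\<in>P. infinite {m. (n, m) \<in> p}) \<and>
    (\<forall>p\<in>P. \<forall>q\<in>P. finite {m. (n, m) \<in> p - q} \<or> finite {m. (n, m) \<in> q - p})"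
proof -
  have "finite ({n} \<times> UNIV \<inter> r) \<longleftrightarrow> finite {m. (n, m) \<in> r}" for r :: "('a \<times> 'b) set"
  proof -
    have "{n} \<times> UNIV \<inter> r = Pair n ` {m. (n, m) \<in> r}" by auto
    moreover have "inj_on (Pair n) {m. (n, m) \<in> r}" by (simp add: inj_on_def)
    ultimately show ?thesis by (simp add: finite_image_iff)
  qed
  then show ?thesis unfolding tau_trace_def Int_Diff by simp
qed

lemma infinite_fst_subset:
  assumes "infinite D" "\<And>n. n \<in> D \<Longrightarrow> \<exists>m. (n, m) \<in> G"
  shows "infinite G"
proof
  assume "finite G"
  then have "finite (fst ` G)" by blast
  moreover have "D \<subseteq> fst ` G" using assms(2) by force
  ultimately show False using assms(1) finite_subset by blast
qed

section \<open>Points built from a tower\<close>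

text \<open>The shift by \<open>n\<close> makes an entry of row \<open>n\<close> stand for a number
  that is at least \<open>n\<close>, so that entries from infinitely many rows yield an infinite set
  of numbers.\<close>

definition tower_matrix :: "nat set \<Rightarrow> nat set \<Rightarrow> (nat \<times> nat) set" where
  "tower_matrix t s = {(n, m). n \<in> s \<longrightarrow> n + m \<in> t}"

definition tower_points :: "nat set set \<Rightarrow> nat set set \<Rightarrow> (nat \<times> nat) set set" where
  "tower_points T S = (\<lambda>(t, s). tower_matrix t s) ` (T \<times> S) \<union> range (\<lambda>k. - {k})"

text \<open>A row of a point is full, cofinite or a shift of a tower member, and a shift by a fixed
  \<open>n\<close> respects almost inclusion.\<close>

lemma tau_trace_tower_points_row:
  assumes "tower T"
  shows "tau_trace (tower_points T S) ({n} \<times> UNIV)"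
proof -
  have inj: "inj_on (\<lambda>m. n + m) A" for A :: "nat set" by (simp add: inj_on_def)
  have M: "infinite {m. (n, m) \<in> tower_matrix t s}" if "t \<in> T" for t s
  proof (cases "n \<in> s")
    case True
    have "t - {..<n} \<subseteq> (\<lambda>m. n + m) ` {m. n + m \<in> t}"
    proof
      fix k assume "k \<in> t - {..<n}"
      then show "k \<in> (\<lambda>m. n + m) ` {m. n + m \<in> t}" by (intro image_eqI[of _ _ "k - n"]) auto
    qed
    moreover have "infinite (t - {..<n})" using assms that by (simp add: tower_def)
    ultimately have "infinite {m. n + m \<in> t}" using finite_subset by blast
    then show ?thesis using True by (simp add: tower_matrix_def)
  qed (simp add: tower_matrix_def)
  have sing: "finite {m. (n, m) \<in> p - - {k}}" for p k
    by (rule finite_subset[of _ "{snd k}"]) (cases k; auto)+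
  have cofin: "infinite {m. (n, m) \<in> - {k}}" for k :: "nat \<times> nat"
  proof -
    have "infinite (- {snd k})" by (simp add: Compl_eq_Diff_UNIV)
    moreover have "- {snd k} \<subseteq> {m. (n, m) \<in> - {k}}" by (cases k) auto
    ultimately show ?thesis using finite_subset by blast
  qed
  have le: "finite {m. (n, m) \<in> tower_matrix t s - tower_matrix t' s'}"
    if "n \<in> s \<or> n \<notin> s'" "finite (t - t')" for t t' s s'
  proof -
    have "finite ((\<lambda>m. n + m) ` {m. n + m \<in> t - t'})"
      using that(2) by (rule rev_finite_subset) auto
    then have "finite {m. n + m \<in> t - t'}" using inj finite_imageD by blast
    then show ?thesis by (rule rev_finite_subset) (use that(1) in \<open>auto simp: tower_matrix_def\<close>)
  qed
  have "finite {m. (n, m) \<in> tower_matrix t s - tower_matrix t' s'} \<or>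
      finite {m. (n, m) \<in> tower_matrix t' s' - tower_matrix t s}" if "t \<in> T" "t' \<in> T" for t t' s s'
  proof (cases "n \<in> s \<and> n \<in> s'")
    case True
    then show ?thesis using le[of s s' t t'] le[of s' s t' t] assms that
      by (auto simp: tower_def subset_star_def)
  next
    case False
    have "{m. (n, m) \<in> tower_matrix t s - tower_matrix t' s'} = {}" if "n \<notin> s'"
      using that by (auto simp: tower_matrix_def)
    moreover have "{m. (n, m) \<in> tower_matrix t' s' - tower_matrix t s} = {}" if "n \<notin> s"
      using that by (auto simp: tower_matrix_def)
    ultimately show ?thesis using False by (metis finite.emptyI)
  qed
  note comp = this
  have points: "(\<exists>t\<in>T. \<exists>s. p = tower_matrix t s) \<or> (\<exists>k. p = - {k})" if "p \<in> tower_points T S" for p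
    using that by (auto simp: tower_points_def)
  show ?thesis
    unfolding tau_trace_row_iff
  proof (intro conjI ballI)
    fix p q assume p: "p \<in> tower_points T S" and q: "q \<in> tower_points T S"
    show "infinite {m. (n, m) \<in> p}" using points[OF p] M cofin by (elim disjE bexE exE) simp_all
    show "finite {m. (n, m) \<in> p - q} \<or> finite {m. (n, m) \<in> q - p}"
    proof (cases "(\<exists>k. p = - {k}) \<or> (\<exists>k. q = - {k})")
      case True
      then show ?thesis using sing by metis
    next
      case False
      then show ?thesis using points[OF p] points[OF q] comp by metis
    qed
  qed
qed

text \<open>With \<open>z n\<close> chosen in \<open>F n\<close>, the numbers \<open>n + z n\<close>
  form an infinite set. It is not a pseudo-intersection of the tower, so some \<open>t\<close> omits
  infinitely many of them.\<close>

lemma infinite_tower_misses: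
  assumes "tower T" "infinite a" "\<And>n. n \<in> a \<Longrightarrow> F n \<noteq> {}"
  shows "\<exists>t\<in>T. infinite {n \<in> a. \<exists>m\<in>F n. n + m \<notin> t}"
proof -
  obtain z where z: "\<And>n. n \<in> a \<Longrightarrow> z n \<in> F n" using assms(3) by (meson ex_in_conv)
  let ?Z = "(\<lambda>n. n + z n) ` a"
  have "infinite ?Z"
    unfolding infinite_nat_iff_unbounded_le
  proof
    fix N
    obtain n where "n \<in> a" "N \<le> n" using assms(2) infinite_nat_iff_unbounded_le by blast
    then show "\<exists>k\<ge>N. k \<in> ?Z" by (intro exI[of _ "n + z n"]) auto
  qed
  then obtain t where t: "t \<in> T" "infinite (?Z - t)"
    using assms(1) unfolding tower_def pseudo_intersection_def subset_star_def by blast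
  have "?Z - t \<subseteq> (\<lambda>n. n + z n) ` {n \<in> a. \<exists>m\<in>F n. n + m \<notin> t}" using z by blast
  then have "infinite {n \<in> a. \<exists>m\<in>F n. n + m \<notin> t}" using t(2) finite_subset by blast
  then show ?thesis using t(1) by blast
qed

text \<open>In rows from \<open>s\<close>, a selected entry that misses \<open>t\<close> lies in the
  matrix for \<open>- s\<close> only; in the other rows it lies in the matrix for \<open>s\<close>
  only.\<close>

lemma not_tau_trace_tower_points:
  assumes "t \<in> T" "s \<in> S" "- s \<in> S"
    and "infinite {n \<in> s. \<exists>m\<in>F n. n + m \<notin> t}" "infinite {n \<in> - s. \<exists>m\<in>F n. n + m \<notin> t}"
  shows "\<not> tau_trace (tower_points T S) (Sigma UNIV F)"
proof -
  let ?p = "tower_matrix t s" and ?q = "tower_matrix t (- s)"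
  have "infinite (Sigma UNIV F \<inter> ?q - ?p)"
    by (rule infinite_fst_subset[OF assms(4)]) (auto simp: tower_matrix_def)
  moreover have "infinite (Sigma UNIV F \<inter> ?p - ?q)"
    by (rule infinite_fst_subset[OF assms(5)]) (auto simp: tower_matrix_def)
  moreover have "?p \<in> tower_points T S" "?q \<in> tower_points T S"
    using assms(1-3) by (auto simp: tower_points_def)
  ultimately show ?thesis unfolding tau_trace_def by blast
qed

text \<open>The even rows and the odd rows may each need their own tower member. The smaller of the
  two serves both, since up to finitely many rows it is missed wherever the larger one is.\<close>

lemma not_tau_trace_tower_points_parity:
  assumes "tower T"
  shows "\<not> tau_trace (tower_points T {{n. even n}, - {n. even n}}) (range (\<lambda>n. (n, f n)))"
proof -
  have inf: "infinite {n::nat. even n}" "infinite (- {n::nat. even n})"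
    unfolding infinite_nat_iff_unbounded_le
     apply (rule allI, rule_tac x = "2 * m" in exI, simp)
    apply (rule allI, rule_tac x = "Suc (2 * m)" in exI, simp)
    done
  define D where "D t = {n. n + f n \<notin> t}" for t
  have mono: "finite (D t' - D t)" if sub: "subset_star t t'" for t t'
  proof -
    \<comment> \<open>Finitely many exceptional numbers affect finitely many rows, because
      \<open>n \<le> n + f n\<close>.\<close>
    obtain N where N: "\<forall>k\<in>t - t'. k < N"
      using sub unfolding subset_star_def finite_nat_set_iff_bounded by blast
    have "n < N" if "n \<in> D t' - D t" for n
    proof -
      have "n + f n \<in> t - t'" using that by (simp add: D_def)
      then have "n + f n < N" using N by blast
      then show ?thesis by simp
    qed
    then have "D t' - D t \<subseteq> {..<N}" by blast
    then show ?thesis using finite_subset by blast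
  qed
  have ex: "\<exists>t\<in>T. infinite (s \<inter> D t)" if "infinite s" for s
  proof -
    have "{n \<in> s. \<exists>m\<in>{f n}. n + m \<notin> t} = s \<inter> D t" for t by (auto simp: D_def)
    then show ?thesis using infinite_tower_misses[OF assms that, of "\<lambda>n. {f n}"] by simp
  qed
  have shrink: "infinite (s \<inter> D t)" if "infinite (s \<inter> D t')" "subset_star t t'" for s t t'
  proof
    assume "finite (s \<inter> D t)"
    then have "finite ((s \<inter> D t) \<union> (D t' - D t))" using mono[OF that(2)] by simp
    then have "finite (s \<inter> D t')" by (rule rev_finite_subset) blast
    then show False using that(1) by blast
  qed
  let ?e = "{n::nat. even n}"
  obtain t1 t2 where t: "t1 \<in> T" "infinite (?e \<inter> D t1)" "t2 \<in> T" "infinite (- ?e \<inter> D t2)"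
    using ex inf by meson
  have "\<exists>t\<in>T. infinite (?e \<inter> D t) \<and> infinite (- ?e \<inter> D t)"
  proof (cases "subset_star t1 t2")
    case True
    then show ?thesis using t shrink by blast
  next
    case False
    then have "subset_star t2 t1" using assms t(1,3) unfolding tower_def by blast
    then show ?thesis using t shrink by blast
  qed
  then obtain t where t: "t \<in> T" "infinite (?e \<inter> D t)" "infinite (- ?e \<inter> D t)" by blast
  have D_eq: "{n \<in> s. \<exists>m\<in>{f n}. n + m \<notin> t} = s \<inter> D t" for s by (auto simp: D_def)
  have "range (\<lambda>n. (n, f n)) = Sigma UNIV (\<lambda>n. {f n})" by auto
  then show ?thesis
    using not_tau_trace_tower_points[of t T ?e _ "\<lambda>n. {f n}", unfolded D_eq] t by simp
qed

text \<open>A finite selection may skip rows and thereby evade a fixed \<open>s\<close>; a splitting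
  family contains some \<open>s\<close> that splits the rows where the selection misses
  \<open>t\<close>. Complements are added so that both matrices are points.\<close>

lemma not_tau_trace_tower_points_splitting:
  assumes "tower T" "splitting_family S" and fin: "\<And>n. finite (F n)"
  shows "\<not> tau_trace (tower_points T (S \<union> uminus ` S)) (Sigma UNIV F)"
proof
  assume tr: "tau_trace (tower_points T (S \<union> uminus ` S)) (Sigma UNIV F)"
  define a where "a = {n. F n \<noteq> {}}"
  have "infinite a"
  proof
    assume "finite a"
    then have "finite (Sigma a F)" using fin by (intro finite_SigmaI)
    moreover have "Sigma UNIV F \<subseteq> Sigma a F" by (auto simp: a_def)
    ultimately have "finite (Sigma UNIV F)" using finite_subset by blast
    \<comment> \<open>Some point is needed to see that the selection is infinite: its trace on the
      selection must be.\<close>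
    moreover have "- {(0, 0)} \<in> tower_points T (S \<union> uminus ` S)" by (auto simp: tower_points_def)
    ultimately show False using tr by (auto simp: tau_trace_def)
  qed
  then obtain t where t: "t \<in> T" and D: "infinite {n \<in> a. \<exists>m\<in>F n. n + m \<notin> t}" (is "infinite ?D")
    using infinite_tower_misses[OF assms(1) \<open>infinite a\<close>, of F] unfolding a_def by blast
  obtain s where s: "s \<in> S" "infinite (?D \<inter> s)" "infinite (?D - s)"
    using assms(2) D unfolding splitting_family_def by meson
  have "?D \<inter> s \<subseteq> {n \<in> s. \<exists>m\<in>F n. n + m \<notin> t}" "?D - s \<subseteq> {n \<in> - s. \<exists>m\<in>F n. n + m \<notin> t}"
    by auto
  then have "infinite {n \<in> s. \<exists>m\<in>F n. n + m \<notin> t}" "infinite {n \<in> - s. \<exists>m\<in>F n. n + m \<notin> t}"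
    using s(2,3) finite_subset by blast+
  then show False
    using not_tau_trace_tower_points[OF t, of s "S \<union> uminus ` S" F] s(1) tr by blast
qed

section \<open>Points built from an unbounded family\<close>

text \<open>For \<open>g n \<le> f n\<close> the gap in row \<open>n\<close> is empty and the row is
  full, so \<open>f\<close> and \<open>g\<close> may range over all pairs.\<close>

definition gap_matrix :: "(nat \<Rightarrow> nat) \<Rightarrow> (nat \<Rightarrow> nat) \<Rightarrow> (nat \<times> nat) set" where
  "gap_matrix f g = {(n, m). m < f n \<or> g n \<le> m}"

definition gap_points :: "(nat \<Rightarrow> nat) set \<Rightarrow> (nat \<times> nat) set set" where
  "gap_points F = (\<lambda>(f, g). gap_matrix f g) ` (F \<times> F) \<union> range (\<lambda>k. - {k})"

lemma tau_trace_gap_points_row: "tau_trace (gap_points F) ({n} \<times> UNIV)"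
proof -
  have cofin: "finite {m. (n, m) \<notin> p}" if p: "p \<in> gap_points F" for p
  proof -
    have "(\<exists>f g. p = gap_matrix f g) \<or> (\<exists>k. p = - {k})"
      using p by (auto simp: gap_points_def)
    moreover have "finite {m. (n, m) \<notin> gap_matrix f g}" for f g
      by (rule finite_subset[of _ "{..g n}"]) (auto simp: gap_matrix_def)
    moreover have "finite {m. (n, m) \<notin> - {k}}" for k :: "nat \<times> nat"
      by (rule finite_subset[of _ "{snd k}"]) (cases k; auto)+
    ultimately show ?thesis by blast
  qed
  have "infinite {m. (n, m) \<in> p}" if "p \<in> gap_points F" for p
  proof
    assume "finite {m. (n, m) \<in> p}"
    then have "finite ({m. (n, m) \<in> p} \<union> {m. (n, m) \<notin> p})" using cofin[OF that] by simp
    moreover have "{m. (n, m) \<in> p} \<union> {m. (n, m) \<notin> p} = UNIV" by blast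
    ultimately show False by simp
  qed
  moreover have "finite {m. (n, m) \<in> p - q}" if "q \<in> gap_points F" for p q
    by (rule finite_subset[OF _ cofin[OF that]]) auto
  ultimately show ?thesis unfolding tau_trace_row_iff by blast
qed

text \<open>Monotonicity carries unboundedness over to \<open>a\<close>: if \<open>nx k\<close> is
  an element of \<open>a\<close> with \<open>k \<le> nx k\<close>, then
  \<open>h (nx k) < f k\<close> implies \<open>h (nx k) < f (nx k)\<close>.\<close>

lemma mono_unbounded_on_infinite:
  assumes F: "unbounded_family F" "\<And>f. f \<in> F \<Longrightarrow> mono f" and a: "infinite a"
  shows "\<exists>f\<in>F. infinite {n \<in> a. h n < f n}"
proof -
  have "\<forall>k. \<exists>n. n \<in> a \<and> k \<le> n" using a infinite_nat_iff_unbounded_le by blast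
  then obtain nx where nx: "\<And>k. nx k \<in> a" "\<And>k. k \<le> nx k" by metis
  obtain f where f: "f \<in> F" "\<not> le_star f (\<lambda>k. h (nx k))"
    using F(1) by (auto simp: unbounded_family_def)
  have "infinite {n \<in> a. h n < f n}"
    unfolding infinite_nat_iff_unbounded_le
  proof
    fix N
    obtain k where k: "N \<le> k" "h (nx k) < f k"
      using f(2) by (auto simp: le_star_def eventually_sequentially not_le)
    moreover have "f k \<le> f (nx k)" using F(2)[OF f(1)] nx(2) by (rule monoD)
    ultimately show "\<exists>n\<ge>N. n \<in> {n \<in> a. h n < f n}"
      using nx(1) k(1) nx(2)[of k] by (intro exI[of _ "nx k"]) auto
  qed
  then show ?thesis using f(1) by blast
qed

text \<open>First \<open>f\<close> is chosen to exceed the maxima \<open>h\<close> in infinitely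
  many nonempty rows, then \<open>g\<close> to exceed \<open>h\<close> in infinitely many of the
  nonempty rows with \<open>f n \<le> h n\<close>.\<close>

lemma not_tau_trace_gap_points:
  assumes F: "unbounded_family F" "\<And>f. f \<in> F \<Longrightarrow> mono f" and zero: "(\<lambda>_. 0) \<in> F"
    and fin: "\<And>n. finite (G n)"
  shows "\<not> tau_trace (gap_points F) (Sigma UNIV G)"
proof
  assume tr: "tau_trace (gap_points F) (Sigma UNIV G)"
  have matrix: "gap_matrix f g \<in> gap_points F" if "f \<in> F" "g \<in> F" for f g
    using that by (auto simp: gap_points_def)
  have inf: "infinite (Sigma UNIV G \<inter> gap_matrix f g)" if "f \<in> F" "g \<in> F" for f g
    using tr matrix[OF that] by (simp add: tau_trace_def)
  define h where "h n = Max (G n)" for n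
  have h: "h n \<in> G n" if "G n \<noteq> {}" for n using fin that by (simp add: h_def)
  have h_ge: "m \<le> h n" if "m \<in> G n" for n m using fin that by (simp add: h_def)
  have ne_imp_inf: "infinite {n. G n \<noteq> {} \<and> f n \<le> h n}" if f: "f \<in> F" for f
  proof
    assume "finite {n. G n \<noteq> {} \<and> f n \<le> h n}" (is "finite ?a")
    then have "finite (Sigma ?a G)" using fin by (simp add: finite_SigmaI)
    \<comment> \<open>A selected entry outside the gap \<open>[0, f n)\<close> satisfies
      \<open>f n \<le> m \<le> h n\<close>, so an infinite trace needs infinitely many rows with
      \<open>f n \<le> h n\<close>.\<close>
    moreover have "Sigma UNIV G \<inter> gap_matrix (\<lambda>_. 0) f \<subseteq> Sigma ?a G"
      using h_ge by (auto simp: gap_matrix_def intro: le_trans)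
    ultimately show False using inf[OF zero f] finite_subset by blast
  qed
  have "infinite {n. G n \<noteq> {}}"
    using ne_imp_inf[OF zero] by simp
  then obtain f where f: "f \<in> F" "infinite {n \<in> {n. G n \<noteq> {}}. h n < f n}"
    using mono_unbounded_on_infinite[OF F] by blast
  obtain g where g: "g \<in> F" "infinite {n \<in> {n. G n \<noteq> {} \<and> f n \<le> h n}. h n < g n}"
    using mono_unbounded_on_infinite[OF F ne_imp_inf[OF f(1)]] by blast
  have "infinite (Sigma UNIV G \<inter> gap_matrix (\<lambda>_. 0) f - gap_matrix f g)"
    by (rule infinite_fst_subset[OF g(2)]) (use h in \<open>auto simp: gap_matrix_def intro!: exI[of _ "h _"]\<close>)
  moreover have "infinite (Sigma UNIV G \<inter> gap_matrix f g - gap_matrix (\<lambda>_. 0) f)"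
    by (rule infinite_fst_subset[OF f(2)]) (use h in \<open>auto simp: gap_matrix_def intro!: exI[of _ "h _"]\<close>)
  ultimately show False
    using tr matrix[OF zero f(1)] matrix[OF f(1) g(1)] unfolding tau_trace_def by blast
qed

text \<open>Running maxima are monotone and only larger, so the family stays unbounded. The zero
  function provides the gaps that start at 0.\<close>

lemma mono_unbounded_family_exists:
  "\<exists>F. unbounded_family F \<and> (\<forall>f\<in>F. mono f) \<and> (\<lambda>_. 0) \<in> F \<and> |F| \<le>o bounding_number"
proof -
  obtain F where F: "unbounded_family F" "|F| =o bounding_number"
    using unbounded_family_exists min_card_witness unfolding bounding_number_def by metis
  define runmax where "runmax f n = Max (f ` {..n})" for f :: "nat \<Rightarrow> nat" and n :: nat
  have "mono (runmax f)" for f unfolding runmax_def by (intro monoI Max_mono) auto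
  moreover have "f n \<le> runmax f n" for f n unfolding runmax_def by (intro Max_ge) auto
  then have "le_star f g" if "le_star (runmax f) g" for f g
    using that unfolding le_star_def by (auto elim!: eventually_mono intro: le_trans)
  then have "unbounded_family (insert (\<lambda>_. 0) (runmax ` F))"
    using F(1) unfolding unbounded_family_def by blast
  moreover have "|insert (\<lambda>_. 0) (runmax ` F)| \<le>o |F|"
  proof -
    have "|{\<lambda>_. 0} \<union> runmax ` F| \<le>o |F|"
      using unbounded_family_infinite[OF F(1)]
      by (intro card_of_Un_le_infinite finite_card_le_infinite card_of_image) auto
    then show ?thesis by simp
  qed
  ultimately show ?thesis using ordLeq_ordIso_trans[OF _ F(2)]
    by (intro exI[of _ "insert (\<lambda>_. 0) (runmax ` F)"]) (auto simp: mono_def)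
qed

section \<open>Failing spaces of size at most t, s and b\<close>

lemma exists_not_S1_clopen:
  assumes "|UNIV :: real set| \<le>o |UNIV :: 'a set|"
  shows "\<exists>X :: 'a topology. set_of_reals X \<and> |topspace X| \<le>o tower_number \<and>
    \<not> S1 (clopen_tau_covers X) (clopen_tau_covers X)"
proof -
  obtain T where T: "tower T" "|T| =o tower_number" by (rule tower_witness)
  let ?P = "tower_points T {{n. even n}, - {n. even n}}"
  have "|?P| \<le>o |T|"
    unfolding tower_points_def using tower_infinite[OF T(1)]
    by (intro card_of_set_family_le finite_card_le_infinite card_of_mono1 subset_refl) auto
  then have "|?P| \<le>o tower_number" using T(2) ordLeq_ordIso_trans by blast
  moreover have "|?P| \<le>o |UNIV :: 'a set|" using assms by (rule card_of_nat_prod_sets_le)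
  then have "\<exists>X :: 'a topology. set_of_reals X \<and> |topspace X| \<le>o |?P| \<and>
      \<not> S1 (clopen_tau_covers X) (clopen_tau_covers X)"
    using tau_trace_tower_points_row[OF T(1)] not_tau_trace_tower_points_parity[OF T(1)]
    by (intro not_S1_clopen_from_set_family) (auto simp: tower_points_def)
  ultimately show ?thesis using ordLeq_transitive by blast
qed

lemma exists_not_Sfin_clopen_splitting:
  assumes "|UNIV :: real set| \<le>o |UNIV :: 'a set|"
  shows "\<exists>X :: 'a topology. set_of_reals X \<and> |topspace X| \<le>o splitting_number \<and>
    \<not> Sfin (clopen_tau_covers X) (clopen_tau_covers X)"
proof -
  obtain T where T: "tower T" "|T| =o tower_number" by (rule tower_witness)
  obtain S where S: "splitting_family S" "|S| =o splitting_number"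
    using splitting_family_exists min_card_witness unfolding splitting_number_def by metis
  let ?P = "tower_points T (S \<union> uminus ` S)"
  \<comment> \<open>The points involve a tower as well as a splitting family; t \<le> s keeps their
    number within s.\<close>
  have tS: "tower_number \<le>o |S|"
    using tower_number_le_splitting_number S(2) ordIso_symmetric ordLeq_ordIso_trans by blast
  then have TS: "|T| \<le>o |S|" using T(2) ordIso_ordLeq_trans by blast
  have inf: "infinite S" using tS infinite_if_tower_number_le by blast
  have "|S \<union> uminus ` S| \<le>o |S|"
    using inf card_of_mono1[OF subset_refl] card_of_image by (rule card_of_Un_le_infinite)
  then have "|?P| \<le>o |S|"
    unfolding tower_points_def by (rule card_of_set_family_le[OF inf TS])
  then have "|?P| \<le>o splitting_number" using S(2) ordLeq_ordIso_trans by blast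
  moreover have "|?P| \<le>o |UNIV :: 'a set|" using assms by (rule card_of_nat_prod_sets_le)
  then have "\<exists>X :: 'a topology. set_of_reals X \<and> |topspace X| \<le>o |?P| \<and>
      \<not> Sfin (clopen_tau_covers X) (clopen_tau_covers X)"
    using tau_trace_tower_points_row[OF T(1)] not_tau_trace_tower_points_splitting[OF T(1) S(1)]
    by (intro not_Sfin_clopen_from_set_family) (auto simp: tower_points_def)
  ultimately show ?thesis using ordLeq_transitive by blast
qed

lemma exists_not_Sfin_clopen_bounding:
  assumes "|UNIV :: real set| \<le>o |UNIV :: 'a set|"
  shows "\<exists>X :: 'a topology. set_of_reals X \<and> |topspace X| \<le>o bounding_number \<and>
    \<not> Sfin (clopen_tau_covers X) (clopen_tau_covers X)"
proof -
  obtain F where F: "unbounded_family F" "\<And>f. f \<in> F \<Longrightarrow> mono f" "(\<lambda>_. 0) \<in> F"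
    "|F| \<le>o bounding_number"
    using mono_unbounded_family_exists by blast
  let ?P = "gap_points F"
  have "|?P| \<le>o |F|"
    unfolding gap_points_def
    by (intro card_of_set_family_le unbounded_family_infinite[OF F(1)] card_of_mono1 subset_refl)
  then have "|?P| \<le>o bounding_number" using F(4) ordLeq_transitive by blast
  moreover have "|?P| \<le>o |UNIV :: 'a set|" using assms by (rule card_of_nat_prod_sets_le)
  then have "\<exists>X :: 'a topology. set_of_reals X \<and> |topspace X| \<le>o |?P| \<and>
      \<not> Sfin (clopen_tau_covers X) (clopen_tau_covers X)"
    using tau_trace_gap_points_row not_tau_trace_gap_points[OF F(1-3)]
    by (intro not_Sfin_clopen_from_set_family) (auto simp: gap_points_def)
  ultimately show ?thesis using ordLeq_transitive by blast
qed

section \<open>Critical cardinalities\<close>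

text \<open>Borel, open and clopen \<tau>-covers are instances for suitable \<open>\<Phi>\<close>,
  so each bound is proved once for all three.\<close>

definition tau_covers_of :: "('a topology \<Rightarrow> 'a set \<Rightarrow> bool) \<Rightarrow> 'a topology \<Rightarrow> 'a set set set" where
  "tau_covers_of \<Phi> X = {\<U>. countable \<U> \<and> tau_cover X \<U> \<and> (\<forall>U\<in>\<U>. \<Phi> X U)}"

lemma S1_tau_covers_of:
  assumes "|topspace X| <o tower_number" "topspace X \<noteq> {}"
  shows "S1 (tau_covers_of \<Phi> X) (tau_covers_of \<Phi> X)"
  unfolding S1_def
proof (intro allI impI)
  fix \<U> :: "nat \<Rightarrow> 'a set set"
  assume U: "\<forall>n. \<U> n \<in> tau_covers_of \<Phi> X"
  then obtain W where "\<forall>n. W n \<in> \<U> n" "tau_cover X (range W)"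
    using tau_cover_selection_S1[OF assms, of \<U>] by (auto simp: tau_covers_of_def)
  then show "\<exists>W. (\<forall>n. W n \<in> \<U> n) \<and> range W \<in> tau_covers_of \<Phi> X"
    using U by (intro exI[of _ W]) (auto simp: tau_covers_of_def)
qed

lemma Sfin_tau_covers_of:
  assumes "|topspace X| <o splitting_number" "|topspace X| <o bounding_number"
    and "infinite (topspace X)"
  shows "Sfin (tau_covers_of \<Phi> X) (tau_covers_of \<Phi> X)"
  unfolding Sfin_def
proof (intro allI impI)
  fix \<U> :: "nat \<Rightarrow> 'a set set"
  assume U: "\<forall>n. \<U> n \<in> tau_covers_of \<Phi> X"
  then obtain F where F: "\<forall>n. finite (F n) \<and> F n \<subseteq> \<U> n" "tau_cover X (\<Union>n. F n)"
    using tau_cover_selection_Sfin[OF assms, of \<U>] by (auto simp: tau_covers_of_def)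
  have "countable (\<Union>n. F n)" using F(1) by (intro countable_UN) (auto intro: countable_finite)
  then show "\<exists>F. (\<forall>n. finite (F n) \<and> F n \<subseteq> \<U> n) \<and> (\<Union>n. F n) \<in> tau_covers_of \<Phi> X"
    using U F by (intro exI[of _ F]) (auto simp: tau_covers_of_def)
qed

text \<open>Selected sets inherit \<open>\<Psi>\<close> from the given covers. Read
  contrapositively, failure for clopen covers gives failure for open and Borel ones.\<close>

lemma S1_tau_covers_of_mono:
  assumes "S1 (tau_covers_of \<Phi> X) (tau_covers_of \<Phi> X)" and "\<And>U. \<Psi> X U \<Longrightarrow> \<Phi> X U"
  shows "S1 (tau_covers_of \<Psi> X) (tau_covers_of \<Psi> X)"
  unfolding S1_def
proof (intro allI impI)
  fix \<U> :: "nat \<Rightarrow> 'a set set"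
  assume U: "\<forall>n. \<U> n \<in> tau_covers_of \<Psi> X"
  then have "\<U> n \<in> tau_covers_of \<Phi> X" for n using assms(2) by (auto simp: tau_covers_of_def)
  then obtain W where "\<forall>n. W n \<in> \<U> n" "range W \<in> tau_covers_of \<Phi> X"
    using S1D[OF assms(1), of \<U>] by blast
  then show "\<exists>W. (\<forall>n. W n \<in> \<U> n) \<and> range W \<in> tau_covers_of \<Psi> X"
    using U by (intro exI[of _ W]) (auto simp: tau_covers_of_def)
qed

lemma Sfin_tau_covers_of_mono:
  assumes "Sfin (tau_covers_of \<Phi> X) (tau_covers_of \<Phi> X)" and "\<And>U. \<Psi> X U \<Longrightarrow> \<Phi> X U"
  shows "Sfin (tau_covers_of \<Psi> X) (tau_covers_of \<Psi> X)"
  unfolding Sfin_def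
proof (intro allI impI)
  fix \<U> :: "nat \<Rightarrow> 'a set set"
  assume U: "\<forall>n. \<U> n \<in> tau_covers_of \<Psi> X"
  then have "\<U> n \<in> tau_covers_of \<Phi> X" for n using assms(2) by (auto simp: tau_covers_of_def)
  then obtain F where "\<forall>n. finite (F n) \<and> F n \<subseteq> \<U> n" "(\<Union>n. F n) \<in> tau_covers_of \<Phi> X"
    using SfinD[OF assms(1), of \<U>] by meson
  then show "\<exists>F. (\<forall>n. finite (F n) \<and> F n \<subseteq> \<U> n) \<and> (\<Union>n. F n) \<in> tau_covers_of \<Psi> X"
    using U by (intro exI[of _ F]) (auto simp: tau_covers_of_def)
qed

text \<open>A failing space of size at most \<open>\<kappa>\<close> has size exactly
  \<open>\<kappa>\<close>, since smaller spaces satisfy \<open>Q\<close>.\<close>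

lemma critical_cardinalityI:
  fixes Q :: "'a topology \<Rightarrow> bool"
  assumes \<kappa>: "Card_order \<kappa>"
    and lower: "\<And>X. set_of_reals X \<Longrightarrow> |topspace X| <o \<kappa> \<Longrightarrow> Q X"
    and upper: "\<exists>X. set_of_reals X \<and> |topspace X| \<le>o \<kappa> \<and> \<not> Q X"
  shows "critical_cardinality Q \<kappa>"
proof -
  have le: "\<kappa> \<le>o |topspace X|" if "set_of_reals X" "\<not> Q X" for X
    using lower that not_card_less_Card_order_iff[OF \<kappa>] by blast
  then show ?thesis
    unfolding critical_cardinality_def is_min_card_def using upper ordIso_iff_ordLeq by blast
qed

text \<open>The embeddings into the sum type preserve cardinality, so the minimum is one of the two
  cardinals; this decides which of the two failing spaces is used for \<open>Sfin\<close>.\<close>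

lemma cmin_ordIso:
  fixes r :: "'a rel" and s :: "'b rel"
  assumes "Card_order r" "Card_order s"
  shows "cmin r s =o r \<or> cmin r s =o s"
proof -
  have "|(Inl :: 'a \<Rightarrow> 'a + 'b) ` Field r| =o |Field r|"
    "|(Inr :: 'b \<Rightarrow> 'a + 'b) ` Field s| =o |Field s|"
    by (meson card_of_ordIso bij_betw_imageI inj_Inl inj_Inr inj_on_subset ordIso_symmetric subset_UNIV)+
  then have "|(Inl :: 'a \<Rightarrow> 'a + 'b) ` Field r| =o r" "|(Inr :: 'b \<Rightarrow> 'a + 'b) ` Field s| =o s"
    using assms card_of_Field_ordIso ordIso_transitive by blast+
  then show ?thesis unfolding cmin_def by (cases "r \<le>o s") (simp_all only: if_True if_False simp_thms)
qed

lemma cmin_le: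
  fixes r :: "'a rel" and s :: "'b rel"
  assumes "Card_order r" "Card_order s"
  shows "cmin r s \<le>o r" "cmin r s \<le>o s"
proof -
  have "|(Inl :: 'a \<Rightarrow> 'a + 'b) ` Field r| \<le>o r" "|(Inr :: 'b \<Rightarrow> 'a + 'b) ` Field s| \<le>o s"
    using card_of_image card_of_Field_ordIso assms ordLeq_ordIso_trans by blast+
  moreover have "r \<le>o s \<or> s \<le>o r"
    using assms by (metis card_order_on_well_order_on ordLeq_total)
  ultimately show "cmin r s \<le>o r" "cmin r s \<le>o s"
    unfolding cmin_def using ordLeq_transitive by auto
qed

lemma critical_cardinality_S1_tau_covers_of:
  fixes \<Phi> :: "'a topology \<Rightarrow> 'a set \<Rightarrow> bool"
  assumes "|UNIV :: real set| \<le>o |UNIV :: 'a set|"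
    and clopen: "\<And>X U. openin X U \<Longrightarrow> closedin X U \<Longrightarrow> \<Phi> X U"
  shows "critical_cardinality (\<lambda>X. S1 (tau_covers_of \<Phi> X) (tau_covers_of \<Phi> X)) tower_number"
proof (rule critical_cardinalityI[OF Card_order_tower_number])
  show "S1 (tau_covers_of \<Phi> X) (tau_covers_of \<Phi> X)"
    if "set_of_reals X" "|topspace X| <o tower_number" for X
    using that by (intro S1_tau_covers_of) (auto simp: set_of_reals_def)
  have "clopen_tau_covers X = tau_covers_of (\<lambda>X U. openin X U \<and> closedin X U) X" for X :: "'a topology"
    by (simp add: clopen_tau_covers_def tau_covers_of_def)
  then show "\<exists>X. set_of_reals X \<and> |topspace X| \<le>o tower_number \<and>
      \<not> S1 (tau_covers_of \<Phi> X) (tau_covers_of \<Phi> X)"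
    using exists_not_S1_clopen[OF assms(1)] clopen
      S1_tau_covers_of_mono[of \<Phi> _ "\<lambda>X U. openin X U \<and> closedin X U"] by metis
qed

lemma critical_cardinality_Sfin_tau_covers_of:
  fixes \<Phi> :: "'a topology \<Rightarrow> 'a set \<Rightarrow> bool"
  assumes "|UNIV :: real set| \<le>o |UNIV :: 'a set|"
    and clopen: "\<And>X U. openin X U \<Longrightarrow> closedin X U \<Longrightarrow> \<Phi> X U"
  shows "critical_cardinality (\<lambda>X. Sfin (tau_covers_of \<Phi> X) (tau_covers_of \<Phi> X))
    (cmin splitting_number bounding_number)"
proof (rule critical_cardinalityI)
  let ?\<kappa> = "cmin splitting_number bounding_number"
  show "Card_order ?\<kappa>" by (simp add: cmin_def card_of_Card_order)
  show "Sfin (tau_covers_of \<Phi> X) (tau_covers_of \<Phi> X)"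
    if "set_of_reals X" "|topspace X| <o ?\<kappa>" for X
    using that cmin_le[OF Card_order_splitting_number Card_order_bounding_number]
    by (intro Sfin_tau_covers_of) (auto simp: set_of_reals_def intro: ordLess_ordLeq_trans)
  have "\<exists>X :: 'a topology. set_of_reals X \<and> |topspace X| \<le>o ?\<kappa> \<and>
      \<not> Sfin (clopen_tau_covers X) (clopen_tau_covers X)"
    using cmin_ordIso[OF Card_order_splitting_number Card_order_bounding_number]
      exists_not_Sfin_clopen_splitting[OF assms(1)] exists_not_Sfin_clopen_bounding[OF assms(1)]
      ordIso_symmetric ordLeq_ordIso_trans by metis
  moreover have "clopen_tau_covers X = tau_covers_of (\<lambda>X U. openin X U \<and> closedin X U) X"
    for X :: "'a topology"
    by (simp add: clopen_tau_covers_def tau_covers_of_def)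
  ultimately show "\<exists>X. set_of_reals X \<and> |topspace X| \<le>o ?\<kappa> \<and>
      \<not> Sfin (tau_covers_of \<Phi> X) (tau_covers_of \<Phi> X)"
    using clopen Sfin_tau_covers_of_mono[of \<Phi> _ "\<lambda>X U. openin X U \<and> closedin X U"] by metis
qed

theorem theorem3p3:
  assumes universe: "|UNIV :: real set| \<le>o |UNIV :: 'a set|"
  shows
   "(critical_cardinality
       (\<lambda>X :: 'a topology. S1 (borel_tau_covers X) (borel_tau_covers X)) tower_number \<and>
     critical_cardinality
       (\<lambda>X :: 'a topology. S1 (open_tau_covers X) (open_tau_covers X)) tower_number \<and>
     critical_cardinality
       (\<lambda>X :: 'a topology. S1 (clopen_tau_covers X) (clopen_tau_covers X)) tower_number)
    \<and>
    (critical_cardinality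
       (\<lambda>X :: 'a topology. Sfin (borel_tau_covers X) (borel_tau_covers X))
       (cmin splitting_number bounding_number) \<and>
     critical_cardinality
       (\<lambda>X :: 'a topology. Sfin (open_tau_covers X) (open_tau_covers X))
       (cmin splitting_number bounding_number) \<and>
     critical_cardinality
       (\<lambda>X :: 'a topology. Sfin (clopen_tau_covers X) (clopen_tau_covers X))
       (cmin splitting_number bounding_number))"
proof -
  have covers: "borel_tau_covers = (tau_covers_of borel_in :: 'a topology \<Rightarrow> _)"
    "open_tau_covers = (tau_covers_of openin :: 'a topology \<Rightarrow> _)"
    "clopen_tau_covers = (tau_covers_of (\<lambda>X U. openin X U \<and> closedin X U) :: 'a topology \<Rightarrow> _)"
    by (simp_all add: fun_eq_iff borel_tau_covers_def open_tau_covers_def clopen_tau_covers_def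
        tau_covers_of_def)
  have borel: "borel_in X U" if "openin X U" for X :: "'a topology" and U
    using that by (simp add: borel_in_def sigma_sets.Basic)
  show ?thesis
    unfolding covers using borel
    by (intro conjI critical_cardinality_S1_tau_covers_of[OF universe]
        critical_cardinality_Sfin_tau_covers_of[OF universe]) auto
qed

end
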